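(* Let $W$ be a radial weight with $m_0=1$, let $T$ be a random variable with density $W$ on $[0,\infty)$, and put $s=m_1=\mathbb E\,T$. Let $\nu$ be the law of $\max(T,s)$. Then $\nu$ satisfies $$\int t^k\,d\nu(t)\ge m_k\quad\text{and}\quad s\int t^{k-1}\,d\nu(t)\le m_k\qquad\text{for every integer }k\ge1$$ if and only if $$s\,\mathbb E\,(T-s)_+\ \le\ \operatorname{Var}T.$$ In that case the Korenblum radius of $F^2_W$ equals $\sqrt{m_1/m_0}$, and this radius is admissible for $F^2_W$.
   Context: A radial weight is a measurable function $W\ge0$ on $[0,\infty)$, not almost everywhere zero, whose moments $m_k=\int_0^\infty t^kW(t)\,dt$, $k=0,1,2,\dots$, are all finite. We write $u_+=\max(u,0)$. $F^2_W$ is the space of entire functions $f$ with $\|f\|_W^2=\frac1\pi\int_{\mathbb C}|f(z)|^2W(|z|^2)\,dA(z)<\infty$, where $dA$ is area measure on $\mathbb C$. A radius $R>0$ is admissible for $F^2_W$ if $\|f\|_W\le\|g\|_W$ for all $f,g\in F^2_W$ with $|f(z)|\le|g(z)|$ for $|z|>R$. The Korenblum radius of $F^2_W$ is the supremum of the admissible radii. *)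

theory Defs
  imports "HOL-Probability.Probability" "HOL-Complex_Analysis.Complex_Analysis"
begin

text \<open>
  A radial weight is a function on the half-line, represented by a total function
  \<^typ>\<open>real \<Rightarrow> real\<close> whose values at negative arguments are never used.
  Measurability is Lebesgue measurability.
\<close>

definition radial_weight :: "(real \<Rightarrow> real) \<Rightarrow> bool" where
  "radial_weight W \<longleftrightarrow>
     set_borel_measurable lebesgue {0..} W \<and>
     (\<forall>t\<ge>0. W t \<ge> 0) \<and>
     \<not> (AE t in lebesgue. t \<ge> 0 \<longrightarrow> W t = 0) \<and>
     (\<forall>k::nat. set_integrable lebesgue {0..} (\<lambda>t. t ^ k * W t))"

definition weight_moment :: "(real \<Rightarrow> real) \<Rightarrow> nat \<Rightarrow> real" where
  "weight_moment W k = (LINT t:{0..}|lebesgue. t ^ k * W t)"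

definition fock_space :: "(real \<Rightarrow> real) \<Rightarrow> (complex \<Rightarrow> complex) set" where
  "fock_space W = {f. f holomorphic_on UNIV \<and>
     integrable lebesgue (\<lambda>z. (cmod (f z))\<^sup>2 * W ((cmod z)\<^sup>2))}"

definition fock_norm :: "(real \<Rightarrow> real) \<Rightarrow> (complex \<Rightarrow> complex) \<Rightarrow> real" where
  "fock_norm W f = sqrt (1 / pi * (LINT z|lebesgue. (cmod (f z))\<^sup>2 * W ((cmod z)\<^sup>2)))"

definition admissible_radius :: "(real \<Rightarrow> real) \<Rightarrow> real \<Rightarrow> bool" where
  "admissible_radius W R \<longleftrightarrow> R > 0 \<and>
     (\<forall>f\<in>fock_space W. \<forall>g\<in>fock_space W.
        (\<forall>z. cmod z > R \<longrightarrow> cmod (f z) \<le> cmod (g z)) \<longrightarrow> fock_norm W f \<le> fock_norm W g)"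

text \<open>
  The supremum is taken in \<^typ>\<open>ereal\<close>, so that it is meaningful without knowing that the set of
  admissible radii is bounded; on \<^typ>\<open>real\<close> an unbounded supremum would be unspecified.
\<close>

definition korenblum_radius :: "(real \<Rightarrow> real) \<Rightarrow> ereal" where
  "korenblum_radius W = (SUP R\<in>{R. admissible_radius W R}. ereal R)"

text \<open>
  \<open>T\<close> has density \<open>W\<close> on the half-line. For Borel measurable \<open>W\<close> this is
  \<^const>\<open>distributed\<close> with respect to \<^const>\<open>lborel\<close> and the density \<open>W\<close> extended by zero;
  \<^const>\<open>distributed\<close> itself would require the density to be Borel measurable.
\<close>

definition has_density_on_half_line :: "'a measure \<Rightarrow> ('a \<Rightarrow> real) \<Rightarrow> (real \<Rightarrow> real) \<Rightarrow> bool" where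
  "has_density_on_half_line M T W \<longleftrightarrow>
     T \<in> borel_measurable M \<and>
     (\<forall>A\<in>sets borel. emeasure M (T -` A \<inter> space M) =
        (\<integral>\<^sup>+t\<in>A \<inter> {0..}. ennreal (W t) \<partial>lebesgue))"

end

(* If f and g are entire and |f| <= |g| for |z| > R, then f = q g there with q analytic and bounded
   by 1, also at infinity.  On a circle |z| = r > R, multiplication by q maps the tail
   sum_{k>=n} b_k z^k of g to the tail of f plus a function with frequencies below n, so Parseval gives
   sum_{k>=n} |a_k|^2 r^(2k) <= sum_{k>=n} |b_k|^2 r^(2k) for every n; let r -> R.  For R^2 = m_1/m_0
   the ratios m_k / R^(2k) are nondecreasing, and since ||f||^2 = sum |a_k|^2 m_k, Abel summation
   yields ||f|| <= ||g||.  The pair f = R, g = z shows that no larger radius is admissible.  The moment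
   conditions on max(T,s) reduce to the one for k = 2, because t^k - s max(t,s)^(k-1) dominates a
   nonnegative multiple of t^2 - s max(t,s) plus a multiple of t - s. *)

theory Submission
  imports Defs
begin

text \<open>The quotient q is controlled only outside a disc, so on a circle it carries only
  frequencies at most zero: multiplying by q moves coefficients of g downwards, never upwards. This
  is why tails, and not single coefficients or initial sums, are compared. The coefficients of f and
  g below index n contribute only a function orthogonal to the tail of f, and discarding it merely
  weakens an inequality in the right direction. Radii r > R come first because q is then analytic
  across the circle. The growth of m_k / R^(2k) is Chebyshev's inequality: (t^k - s^k)(t - s) >= 0
  is integrated against W, and the mean of t - s is zero. The formula for the norm rests on two
  facts about area measure: it is invariant under rotations, and it is carried by |z|^2 to pi times
  length on the half-line. Averaging over rotations replaces |f|^2 by its circle means, which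
  Parseval evaluates. Since W is only Lebesgue measurable, these computations run with a Borel
  version of W, and the exceptional null set has to be pulled back along |z|^2.\<close>

section \<open>Mean values and orthogonality on the unit circle\<close>

lemma has_integral_unit_circle_mean:
  assumes "h holomorphic_on cball 0 1"
  shows "((\<lambda>t. h (cis (2 * pi * t))) has_integral h 0) {0..1}"
proof -
  have eq: "circlepath 0 1 t = cis (2 * pi * t)" for t
    by (simp add: circlepath cis_conv_exp mult_ac)
  have "((\<lambda>u. h u / (u - 0)) has_contour_integral (2 * of_real pi * \<i> * h 0)) (circlepath 0 1)"
    by (rule Cauchy_integral_circlepath_simple) (use assms in auto)
  hence "((\<lambda>t. h (circlepath 0 1 t) / circlepath 0 1 t *
            (2 * of_real pi * \<i> * circlepath 0 1 t)) has_integral (2 * of_real pi * \<i> * h 0)) {0..1}"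
    unfolding has_contour_integral_def
    by (rule has_integral_eq[rotated])
       (simp add: vector_derivative_circlepath01 eq, simp add: cis_conv_exp mult_ac)
  hence "((\<lambda>t. (2 * of_real pi * \<i>) * h (cis (2 * pi * t))) has_integral (2 * of_real pi * \<i> * h 0)) {0..1}"
    by (rule has_integral_eq[rotated]) (simp add: eq)
  hence "((\<lambda>t. inverse (2 * of_real pi * \<i>) * ((2 * of_real pi * \<i>) * h (cis (2 * pi * t)))) has_integral
      inverse (2 * of_real pi * \<i>) * (2 * of_real pi * \<i> * h 0)) {0..1}"
    by (rule has_integral_mult_right)
  moreover have "inverse (2 * of_real pi * \<i>) * (2 * of_real pi * \<i> * x) = x" for x
    by (simp add: field_simps)
  ultimately show ?thesis by (simp only:)
qed

lemma continuous_on_compose_unit_circle: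
  fixes h :: "complex \<Rightarrow> 'b::topological_space"
  assumes "continuous_on (cball 0 1) h"
  shows "continuous_on A (\<lambda>t::real. h (cis (2 * pi * t)))"
  by (rule continuous_on_compose2[OF assms]) (auto intro!: continuous_intros)

text \<open>\<open>F\<close> has frequencies >= 0 on the circle and \<open>cnj G\<close> has
  frequencies <= 0, so they can interact only through their constant terms. Concretely, the cross
  term is 2 Re (F G), and the mean of the holomorphic product F G is its value at 0.\<close>

lemma integral_unit_circle_pythagoras:
  assumes F: "F holomorphic_on cball 0 1" and G: "G holomorphic_on cball 0 1" and "F 0 * G 0 = 0"
  shows "integral {0..1} (\<lambda>t. (cmod (F (cis (2 * pi * t)) + cnj (G (cis (2 * pi * t)))))\<^sup>2) =
         integral {0..1} (\<lambda>t. (cmod (F (cis (2 * pi * t))))\<^sup>2) +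
         integral {0..1} (\<lambda>t. (cmod (G (cis (2 * pi * t))))\<^sup>2)"
proof -
  let ?c = "\<lambda>t::real. cis (2 * pi * t)"
  have cF: "continuous_on (cball 0 1) F" and cG: "continuous_on (cball 0 1) G"
    using F G holomorphic_on_imp_continuous_on by blast+
  have 1: "((\<lambda>t. (cmod (F (?c t)))\<^sup>2) has_integral integral {0..1} (\<lambda>t. (cmod (F (?c t)))\<^sup>2)) {0..1}"
    by (intro integrable_integral integrable_continuous_real continuous_intros
          continuous_on_compose_unit_circle cF)
  have 2: "((\<lambda>t. (cmod (G (?c t)))\<^sup>2) has_integral integral {0..1} (\<lambda>t. (cmod (G (?c t)))\<^sup>2)) {0..1}"
    by (intro integrable_integral integrable_continuous_real continuous_intros
          continuous_on_compose_unit_circle cG)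
  have "((\<lambda>t. (\<lambda>z. F z * G z) (?c t)) has_integral (F 0 * G 0)) {0..1}"
    by (rule has_integral_unit_circle_mean) (intro holomorphic_intros F G)
  hence "((\<lambda>t. F (?c t) * G (?c t)) has_integral 0) {0..1}"
    using assms(3) by simp
  hence 3: "((\<lambda>t. 2 * Re (F (?c t) * G (?c t))) has_integral 2 * Re 0) {0..1}"
    by (intro has_integral_mult_right has_integral_Re)
  have "(cmod (a + cnj b))\<^sup>2 = (cmod a)\<^sup>2 + (cmod b)\<^sup>2 + 2 * Re (a * b)" for a b
    unfolding cmod_power2 by (simp add: power2_eq_square algebra_simps)
  hence "((\<lambda>t. (cmod (F (?c t) + cnj (G (?c t))))\<^sup>2) has_integral
      (integral {0..1} (\<lambda>t. (cmod (F (?c t)))\<^sup>2) + integral {0..1} (\<lambda>t. (cmod (G (?c t)))\<^sup>2) + 2 * Re 0)) {0..1}"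
    using has_integral_add[OF has_integral_add[OF 1 2] 3] by simp
  thus ?thesis by (simp add: integral_unique)
qed

section \<open>Everywhere convergent power series and Parseval's identity\<close>

text \<open>Entire functions are handled through their coefficient sequences, so that tails and
  dilations become operations on sequences.\<close>

definition power_series :: "(nat \<Rightarrow> complex) \<Rightarrow> complex \<Rightarrow> complex" where
  "power_series a z = (\<Sum>k. a k * z ^ k)"

definition everywhere_convergent :: "(nat \<Rightarrow> complex) \<Rightarrow> bool" where
  "everywhere_convergent a \<longleftrightarrow> (\<forall>z. summable (\<lambda>k. a k * z ^ k))"

lemma everywhere_convergent_summable_norm:
  assumes "everywhere_convergent a"
  shows "summable (\<lambda>k. cmod (a k * z ^ k))"
  by (rule powser_insidea[of a "of_real (norm z + 1)"])
     (use assms in \<open>auto simp: everywhere_convergent_def\<close>)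

lemma everywhere_convergent_Suc:
  assumes "everywhere_convergent a"
  shows "everywhere_convergent (\<lambda>k. a (Suc k))"
  using assms summable_powser_split_head[of a] by (simp add: everywhere_convergent_def)

lemma everywhere_convergent_shift:
  assumes "everywhere_convergent a"
  shows "everywhere_convergent (\<lambda>k. a (k + n))"
proof (induction n)
  case (Suc n)
  from everywhere_convergent_Suc[OF this] show ?case by simp
qed (use assms in simp)

lemma everywhere_convergent_scale:
  assumes "everywhere_convergent a"
  shows "everywhere_convergent (\<lambda>k. a k * c ^ k)"
  unfolding everywhere_convergent_def
proof
  fix z
  have "summable (\<lambda>k. a k * (c * z) ^ k)"
    using assms by (simp add: everywhere_convergent_def)
  thus "summable (\<lambda>k. a k * c ^ k * z ^ k)"
    by (simp add: power_mult_distrib mult.assoc)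
qed

lemma power_series_scale: "power_series (\<lambda>k. a k * c ^ k) z = power_series a (c * z)"
  by (simp add: power_series_def power_mult_distrib mult.assoc)

lemma power_series_holomorphic:
  assumes "everywhere_convergent a"
  shows "power_series a holomorphic_on A"
proof -
  have "power_series a field_differentiable at z" for z
    unfolding power_series_def field_differentiable_def
    using termdiffs_strong_converges_everywhere[of a] assms
    by (auto simp: everywhere_convergent_def)
  thus ?thesis
    by (auto simp: holomorphic_on_def intro: field_differentiable_at_within)
qed

lemma power_series_split:
  assumes "everywhere_convergent a"
  shows "power_series a z = (\<Sum>k<n. a k * z ^ k) + z ^ n * power_series (\<lambda>k. a (k + n)) z"
proof -
  have s: "summable (\<lambda>k. a k * z ^ k)"
    using assms by (simp add: everywhere_convergent_def)
  have "(\<Sum>k. a (k + n) * z ^ (k + n)) = (\<Sum>k. z ^ n * (a (k + n) * z ^ k))"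
    by (simp add: power_add mult_ac)
  also have "\<dots> = z ^ n * power_series (\<lambda>k. a (k + n)) z"
    unfolding power_series_def
    by (rule suminf_mult) (use everywhere_convergent_shift[OF assms] in \<open>simp add: everywhere_convergent_def\<close>)
  finally have shift: "(\<Sum>k. a (k + n) * z ^ (k + n)) = z ^ n * power_series (\<lambda>k. a (k + n)) z" .
  show ?thesis
    unfolding shift[symmetric] unfolding power_series_def
    by (subst suminf_split_initial_segment[OF s, of n]) (rule add.commute)
qed

definition circle_mean_square :: "(nat \<Rightarrow> complex) \<Rightarrow> real" where
  "circle_mean_square a = integral {0..1} (\<lambda>t. (cmod (power_series a (cis (2 * pi * t))))\<^sup>2)"

text \<open>Pythagoras for the constant term and the remainder, which vanishes at 0; the factor z
  left in the remainder has modulus 1 on the circle.\<close>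

lemma circle_mean_square_Suc:
  assumes a: "everywhere_convergent a"
  shows "circle_mean_square a = (cmod (a 0))\<^sup>2 + circle_mean_square (\<lambda>k. a (Suc k))"
proof -
  let ?c = "\<lambda>t::real. cis (2 * pi * t)"
  let ?F = "\<lambda>z. z * power_series (\<lambda>k. a (Suc k)) z"
  have split: "power_series a z = ?F z + cnj (cnj (a 0))" for z
    using power_series_split[OF a, of z 1] by simp
  have "circle_mean_square a =
     integral {0..1} (\<lambda>t. (cmod (?F (?c t)))\<^sup>2) + integral {0..1} (\<lambda>t::real. (cmod (cnj (a 0)))\<^sup>2)"
    unfolding circle_mean_square_def split
    by (rule integral_unit_circle_pythagoras)
       (intro holomorphic_intros power_series_holomorphic everywhere_convergent_Suc[OF a], simp_all)
  thus ?thesis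
    by (simp add: circle_mean_square_def norm_mult)
qed

lemma circle_mean_square_partial:
  assumes a: "everywhere_convergent a"
  shows "circle_mean_square a = (\<Sum>k<n. (cmod (a k))\<^sup>2) + circle_mean_square (\<lambda>k. a (k + n))"
proof (induction n)
  case (Suc n)
  have "circle_mean_square (\<lambda>k. a (k + n)) = (cmod (a n))\<^sup>2 + circle_mean_square (\<lambda>k. a (k + Suc n))"
    using circle_mean_square_Suc[OF everywhere_convergent_shift[OF a, of n]] by (simp only: add_Suc add_Suc_right add_0)
  with Suc show ?case by (simp only: sum.lessThan_Suc add.assoc)
qed simp

text \<open>After n coefficients have been split off, the error is the mean square of the shifted
  series. It is at most the square of the tail of the absolutely convergent series of coefficients
  (the point z = 1), hence tends to 0.\<close>

lemma parseval_sums: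
  assumes a: "everywhere_convergent a"
  shows "(\<lambda>k. (cmod (a k))\<^sup>2) sums circle_mean_square a"
proof -
  have sn: "summable (\<lambda>k. cmod (a k))"
    using everywhere_convergent_summable_norm[OF a, of 1] by simp
  have bound: "norm (circle_mean_square (\<lambda>k. a (k + n))) \<le> (\<Sum>k. cmod (a (k + n)))\<^sup>2" for n
  proof -
    have cv: "everywhere_convergent (\<lambda>k. a (k + n))"
      by (rule everywhere_convergent_shift[OF a])
    have le: "cmod (power_series (\<lambda>k. a (k + n)) (cis x)) \<le> (\<Sum>k. cmod (a (k + n)))" for x
      unfolding power_series_def
      using summable_norm[OF everywhere_convergent_summable_norm[OF cv, of "cis x"]]
      by (simp add: norm_mult norm_power)
    have "continuous_on (cball 0 1) (power_series (\<lambda>k. a (k + n)))"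
      by (intro holomorphic_on_imp_continuous_on power_series_holomorphic cv)
    hence "(\<lambda>t::real. (cmod (power_series (\<lambda>k. a (k + n)) (cis (2 * pi * t))))\<^sup>2) integrable_on {0..1}"
      by (intro integrable_continuous_real continuous_intros continuous_on_compose_unit_circle)
    note int = this
    hence "circle_mean_square (\<lambda>k. a (k + n)) \<le> integral {0..1} (\<lambda>t::real. (\<Sum>k. cmod (a (k + n)))\<^sup>2)"
      unfolding circle_mean_square_def by (intro integral_le) (auto intro!: power_mono le)
    moreover have "circle_mean_square (\<lambda>k. a (k + n)) \<ge> 0"
      unfolding circle_mean_square_def by (rule Henstock_Kurzweil_Integration.integral_nonneg) (use int in auto)
    ultimately show ?thesis by simp
  qed
  have lim0: "(\<lambda>n. (\<Sum>k. cmod (a (k + n)))\<^sup>2) \<longlonglongrightarrow> 0\<^sup>2"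
    by (intro tendsto_power suminf_exist_split2 sn)
  have "(\<lambda>n. circle_mean_square (\<lambda>k. a (k + n))) \<longlonglongrightarrow> 0"
    using bound by (intro Lim_null_comparison[OF always_eventually lim0[unfolded zero_power2]] allI)
  hence lim: "(\<lambda>n. circle_mean_square a - circle_mean_square (\<lambda>k. a (k + n))) \<longlonglongrightarrow> circle_mean_square a - 0"
    by (intro tendsto_intros)
  show ?thesis
  proof -
    have "circle_mean_square a - circle_mean_square (\<lambda>k. a (k + n)) = (\<Sum>k<n. (cmod (a k))\<^sup>2)" for n
      using circle_mean_square_partial[OF a, of n] by linarith
    with lim show ?thesis by (simp add: sums_def)
  qed
qed

section \<open>Bounded quotients, and their behaviour at infinity\<close>

text \<open>A meromorphic quotient bounded by 1 has no poles, so all its singularities are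
  removable. Nothing is assumed about the zeros of \<open>G\<close>, which may even vanish
  identically on part of \<open>S\<close>.\<close>

lemma bounded_quotient_extension:
  assumes F: "F holomorphic_on S" and G: "G holomorphic_on S" and "open S"
    and le: "\<And>z. z \<in> S \<Longrightarrow> cmod (F z) \<le> cmod (G z)"
  obtains q where "q holomorphic_on S"
    "\<And>z. z \<in> S \<Longrightarrow> F z = q z * G z" "\<And>z. z \<in> S \<Longrightarrow> cmod (q z) \<le> 1"
proof -
  let ?Q = "\<lambda>z. F z / G z"
  \<comment> \<open>Zeros of \<open>G\<close> are covered as well: there the quotient is 0 by the
    convention x / 0 = 0.\<close>
  have Q1: "cmod (?Q z) \<le> 1" if "z \<in> S" for z
    using le[OF that] by (auto simp: norm_divide divide_le_eq_1)
  have ana: "F analytic_on S" "G analytic_on S"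
    using F G \<open>open S\<close> by (auto simp: analytic_on_open)
  have near: "\<forall>\<^sub>F w in at z. w \<in> S" if "z \<in> S" for z
    using \<open>open S\<close> that by (rule eventually_at_in_open')
  have lim: "isolated_singularity_at ?Q z \<and> (\<exists>c. ?Q \<midarrow>z\<rightarrow> c)" if "z \<in> S" for z
  proof -
    have "?Q meromorphic_on {z}"
      using ana that by (intro meromorphic_intros analytic_on_imp_meromorphic_on) (auto intro: analytic_on_subset)
    hence "isolated_singularity_at ?Q z" and "not_essential ?Q z"
      by (auto simp: meromorphic_at_iff)
    moreover have "\<not> is_pole ?Q z"
    proof
      assume "is_pole ?Q z"
      hence "filterlim (\<lambda>w. cmod (?Q w)) at_top (at z)"
        by (auto simp: is_pole_def filterlim_at_infinity_conv_norm_at_top)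
      hence "\<forall>\<^sub>F w in at z. cmod (?Q w) > 1"
        by (auto simp: filterlim_at_top_dense)
      with near[OF that] have "\<forall>\<^sub>F w in at z. False"
        by eventually_elim (use Q1 in force)
      thus False by simp
    qed
    ultimately show ?thesis by (auto simp: not_essential_def)
  qed
  \<comment> \<open>At a zero of \<open>G\<close> the conventional value 0 need not be the limit of
    the quotient; \<open>remove_sings\<close> puts the limit there.\<close>
  define q where "q = remove_sings ?Q"
  have q_lim: "?Q \<midarrow>z\<rightarrow> q z" if z: "z \<in> S" for z
  proof -
    obtain c where c: "?Q \<midarrow>z\<rightarrow> c" using lim[OF z] by blast
    thus ?thesis by (simp only: q_def remove_sings_eqI[OF c])
  qed
  have "q analytic_on S"
    using lim unfolding q_def by (subst analytic_on_analytic_at) (auto intro: remove_sings_analytic_at)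
  hence q: "q holomorphic_on S" by (rule analytic_imp_holomorphic)
  show thesis
  proof
    show "q holomorphic_on S" by fact
  next
    fix z assume z: "z \<in> S"
    show "F z = q z * G z"
    proof (cases "G z = 0")
      case True
      with le[OF z] show ?thesis by simp
    next
      case False
      have "isCont F z" "isCont G z"
        using F G \<open>open S\<close> z holomorphic_on_imp_continuous_on continuous_on_eq_continuous_at by blast+
      hence "?Q \<midarrow>z\<rightarrow> ?Q z"
        using False unfolding isCont_def by (intro tendsto_divide)
      with q_lim[OF z] have "?Q z = q z"
        by (rule LIM_unique[rotated])
      with False show ?thesis by (auto simp: field_simps)
    qed
  next
    fix z assume z: "z \<in> S"
    show "cmod (q z) \<le> 1"
    proof (rule tendsto_upperbound)
      show "((\<lambda>w. cmod (?Q w)) \<longlongrightarrow> cmod (q z)) (at z)"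
        by (intro tendsto_norm q_lim z)
      show "\<forall>\<^sub>F w in at z. cmod (?Q w) \<le> 1"
        using near[OF z] by eventually_elim (use Q1 in auto)
    qed auto
  qed
qed

text \<open>The substitution w = 1/z moves infinity to 0, where a bounded holomorphic function
  extends. On the unit circle 1/z is \<open>cnj z\<close>, which explains the argument of
  \<open>k\<close>. As R < 1, the disc of radius 1/R contains the closed unit disc, so
  \<open>k\<close> is holomorphic across the circle.\<close>

lemma quotient_near_infinity:
  assumes f: "f holomorphic_on UNIV" and g: "g holomorphic_on UNIV" and "0 < R" "R < 1"
    and le: "\<And>z. cmod z > R \<Longrightarrow> cmod (f z) \<le> cmod (g z)"
  obtains k where "k holomorphic_on ball 0 (1 / R)"
    "\<And>z. cmod z = 1 \<Longrightarrow> f z = k (cnj z) * g z" "\<And>z. cmod z = 1 \<Longrightarrow> cmod (k z) \<le> 1"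
proof -
  let ?B = "ball 0 (1 / R) :: complex set"
  have hol: "(\<lambda>w. h (inverse w)) holomorphic_on ?B - {0}" if "h holomorphic_on UNIV" for h
  proof -
    have "inverse holomorphic_on ?B - {0}" by (intro holomorphic_intros) auto
    moreover have "h holomorphic_on inverse ` (?B - {0})"
      using that by (rule holomorphic_on_subset) simp
    ultimately show ?thesis
      using holomorphic_on_compose[of inverse "?B - {0}" h] by (simp add: o_def)
  qed
  have "cmod (f (inverse w)) \<le> cmod (g (inverse w))" if "w \<in> ?B - {0}" for w
    using that \<open>0 < R\<close> by (intro le) (auto simp: norm_inverse inverse_eq_divide norm_divide field_simps)
  then obtain q where q: "q holomorphic_on ?B - {0}"
      "\<And>w. w \<in> ?B - {0} \<Longrightarrow> f (inverse w) = q w * g (inverse w)"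
      "\<And>w. w \<in> ?B - {0} \<Longrightarrow> cmod (q w) \<le> 1"
    using bounded_quotient_extension[OF hol[OF f] hol[OF g]] by (metis open_ball open_delete)
  have "\<forall>\<^sub>F w in at 0. w \<in> ?B - {0}"
    using \<open>0 < R\<close> by (intro eventually_at_in_open) auto
  hence "\<forall>\<^sub>F w in at 0. cmod (q w) \<le> 1"
    by eventually_elim (rule q(3))
  then obtain k where k: "k holomorphic_on ?B" "\<And>w. w \<in> ?B - {0} \<Longrightarrow> k w = q w"
    using holomorphic_on_extend_bounded[OF q(1)] \<open>0 < R\<close> by auto
  have sub: "z \<in> ?B - {0}" if "cmod z = 1" for z
    using that \<open>0 < R\<close> \<open>R < 1\<close> by (auto simp: field_simps)
  have inv: "inverse (cnj z) = z" if "cmod z = 1" for z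
    using that by (metis complex_cnj_cnj complex_norm_square inverse_unique mult.commute of_real_1 power_one)
  show thesis
  proof
    show "k holomorphic_on ?B" by (rule k)
    fix z :: complex assume z: "cmod z = 1"
    show "cmod (k z) \<le> 1"
      using k(2) q(3) sub[OF z] by simp
    show "f z = k (cnj z) * g z"
      using q(2)[OF sub, of "cnj z"] k(2)[OF sub, of "cnj z"] inv[OF z] z by simp
  qed
qed

section \<open>Comparison of coefficient tails\<close>

text \<open>The function \<open>k (cnj u) * ?G u\<close> is the tail of the first series plus a term
  with negative frequencies only. By orthogonality that term can only increase the mean square,
  while the bound on \<open>k\<close> keeps the total below the mean square of
  \<open>?G\<close>.\<close>

lemma circle_mean_square_tail_le:
  assumes a: "everywhere_convergent a" and b: "everywhere_convergent b"
    and k: "k holomorphic_on ball 0 \<rho>" and "\<rho> > 1"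
    and eq: "\<And>z. cmod z = 1 \<Longrightarrow> power_series a z = k (cnj z) * power_series b z"
    and k1: "\<And>z. cmod z = 1 \<Longrightarrow> cmod (k z) \<le> 1"
  shows "circle_mean_square (\<lambda>j. a (j + n)) \<le> circle_mean_square (\<lambda>j. b (j + n))"
proof -
  let ?c = "\<lambda>t::real. cis (2 * pi * t)"
  let ?F = "power_series (\<lambda>j. a (j + n))" and ?G = "power_series (\<lambda>j. b (j + n))"
  \<comment> \<open>Dividing the identity for the full series by u^n leaves, for j < n, the power n
    - j >= 1 of 1/u = \<open>cnj u\<close>. The function \<open>h\<close> collects these leftovers
    of both series; since no exponent is 0, it vanishes at 0.\<close>
  define h where "h w = (\<Sum>j<n. a j * w ^ (n - j)) - k w * (\<Sum>j<n. b j * w ^ (n - j))" for w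
  \<comment> \<open>Chosen so that \<open>cnj (H u) = h (cnj u)\<close> with \<open>H\<close> again
    holomorphic, as \<open>integral_unit_circle_pythagoras\<close> requires.\<close>
  define H where "H = cnj \<circ> h \<circ> cnj"
  have "h holomorphic_on ball 0 \<rho>"
    unfolding h_def by (intro holomorphic_intros k)
  moreover have "cnj ` ball 0 \<rho> = ball 0 \<rho>"
    by (auto simp: image_iff intro!: bexI[of _ "cnj _"])
  ultimately have "H holomorphic_on ball 0 \<rho>"
    unfolding H_def by (intro holomorphic_on_compose_cnj_cnj) auto
  hence H: "H holomorphic_on cball 0 1"
    by (rule holomorphic_on_subset) (use \<open>\<rho> > 1\<close> in auto)
  have H0: "H 0 = 0" by (simp add: H_def h_def power_0_left)
  have F: "?F holomorphic_on cball 0 1"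
    by (intro power_series_holomorphic everywhere_convergent_shift a)
  have G: "?G holomorphic_on cball 0 1"
    by (intro power_series_holomorphic everywhere_convergent_shift b)
  have main: "?F u + cnj (H u) = k (cnj u) * ?G u" if u: "cmod u = 1" for u
  proof -
    have uu: "cnj u * u = 1"
      using u by (metis complex_norm_square mult.commute of_real_1 power_one)
    have pw: "cnj u ^ n * (\<Sum>j<n. d j * u ^ j) = (\<Sum>j<n. d j * cnj u ^ (n - j))" for d :: "nat \<Rightarrow> complex"
      unfolding sum_distrib_left
    proof (intro sum.cong refl)
      fix j assume "j \<in> {..<n}"
      hence "cnj u ^ n = cnj u ^ (n - j) * cnj u ^ j" by (simp flip: power_add)
      thus "cnj u ^ n * (d j * u ^ j) = d j * cnj u ^ (n - j)"
        using uu by (simp add: mult.left_commute mult.assoc flip: power_mult_distrib)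
    qed
    have un: "cnj u ^ n * (u ^ n * x) = x" for x
      using uu by (simp add: mult.assoc[symmetric] flip: power_mult_distrib)
    have "cnj u ^ n * power_series a u = k (cnj u) * (cnj u ^ n * power_series b u)"
      using eq[OF u] by simp
    hence "(\<Sum>j<n. a j * cnj u ^ (n - j)) + ?F u = k (cnj u) * ((\<Sum>j<n. b j * cnj u ^ (n - j)) + ?G u)"
      by (subst (asm) power_series_split[OF a, of _ n], subst (asm) power_series_split[OF b, of _ n])
         (simp only: distrib_left pw un)
    thus ?thesis by (simp add: H_def h_def distrib_left algebra_simps)
  qed
  have cont: "continuous_on (cball 0 1) ?F" "continuous_on (cball 0 1) ?G" "continuous_on (cball 0 1) H"
    using F G H holomorphic_on_imp_continuous_on by blast+
  have int1: "(\<lambda>t. (cmod (?F (?c t) + cnj (H (?c t))))\<^sup>2) integrable_on {0..1}"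
    by (intro integrable_continuous_real continuous_intros continuous_on_compose_unit_circle cont)
  have int2: "(\<lambda>t. (cmod (?G (?c t)))\<^sup>2) integrable_on {0..1}"
    by (intro integrable_continuous_real continuous_intros continuous_on_compose_unit_circle cont)
  have int3: "(\<lambda>t. (cmod (H (?c t)))\<^sup>2) integrable_on {0..1}"
    by (intro integrable_continuous_real continuous_intros continuous_on_compose_unit_circle cont)
  \<comment> \<open>The mean square of \<open>H\<close> is added for free because it is
    nonnegative.\<close>
  have "circle_mean_square (\<lambda>j. a (j + n)) \<le>
      integral {0..1} (\<lambda>t. (cmod (?F (?c t)))\<^sup>2) + integral {0..1} (\<lambda>t. (cmod (H (?c t)))\<^sup>2)"
    using Henstock_Kurzweil_Integration.integral_nonneg[OF int3] by (simp add: circle_mean_square_def)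
  also have "\<dots> = integral {0..1} (\<lambda>t. (cmod (?F (?c t) + cnj (H (?c t))))\<^sup>2)"
    by (rule integral_unit_circle_pythagoras[symmetric]) (use F H H0 in auto)
  also have "\<dots> \<le> integral {0..1} (\<lambda>t. (cmod (?G (?c t)))\<^sup>2)"
  proof (rule integral_le[OF int1 int2])
    fix t :: real
    have "cmod (k (cnj (?c t)) * ?G (?c t)) \<le> 1 * cmod (?G (?c t))"
      unfolding norm_mult by (intro mult_right_mono k1) auto
    thus "(cmod (?F (?c t) + cnj (H (?c t))))\<^sup>2 \<le> (cmod (?G (?c t)))\<^sup>2"
      by (subst main) (auto intro!: power_mono)
  qed
  finally show ?thesis by (simp add: circle_mean_square_def)
qed

lemma cmod_coeff_scale_square:
  "(cmod (d * of_real r ^ j))\<^sup>2 = (cmod d)\<^sup>2 * (r\<^sup>2) ^ j"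
proof -
  have "(\<bar>r\<bar> ^ j)\<^sup>2 = (\<bar>r\<bar>\<^sup>2) ^ j" by (simp only: mult.commute flip: power_mult)
  thus ?thesis by (simp add: norm_mult norm_power power_mult_distrib)
qed

lemma summable_coeff_squares:
  assumes "everywhere_convergent a" and "x \<ge> 0"
  shows "summable (\<lambda>j. (cmod (a j))\<^sup>2 * x ^ j)"
  using sums_summable[OF parseval_sums[OF everywhere_convergent_scale[OF assms(1), of "of_real (sqrt x)"]]]
    \<open>x \<ge> 0\<close> by (simp add: cmod_coeff_scale_square)

text \<open>A finite block on the left suffices, since \<open>N\<close> is arbitrary, and it makes
  the passage to the limit radius trivial on that side: the block is a polynomial in the radius.
  Only the right side needs continuity of a power series.\<close>

lemma tail_sum_le:
  assumes a: "everywhere_convergent a" and b: "everywhere_convergent b" and "R > 0"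
    and le: "\<And>z. cmod z > R \<Longrightarrow> cmod (power_series a z) \<le> cmod (power_series b z)"
  shows "(\<Sum>j\<in>{n..<N}. (cmod (a j))\<^sup>2 * (R\<^sup>2) ^ j) \<le> (\<Sum>j. (cmod (b (j + n)))\<^sup>2 * (R\<^sup>2) ^ (j + n))"
proof -
  \<comment> \<open>Rescaling by r > R turns the circle of radius r into the unit circle and the
    threshold R into R / r < 1, as \<open>quotient_near_infinity\<close> demands.\<close>
  have *: "(\<Sum>j\<in>{n..<N}. (cmod (a j))\<^sup>2 * (r\<^sup>2) ^ j) \<le> (\<Sum>j. (cmod (b (j + n)))\<^sup>2 * (r\<^sup>2) ^ (j + n))"
    if r: "r > R" for r
  proof -
    let ?a = "\<lambda>j. a j * of_real r ^ j" and ?b = "\<lambda>j. b j * of_real r ^ j"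
    have ca: "everywhere_convergent ?a" and cb: "everywhere_convergent ?b"
      by (intro everywhere_convergent_scale a b)+
    have "0 < R / r" "R / r < 1"
      using r \<open>R > 0\<close> by auto
    moreover have "cmod (power_series ?a z) \<le> cmod (power_series ?b z)" if "cmod z > R / r" for z
      unfolding power_series_scale
      using that r \<open>R > 0\<close> by (intro le) (auto simp: norm_mult field_simps)
    ultimately obtain k where k: "k holomorphic_on ball 0 (1 / (R / r))"
      "\<And>z. cmod z = 1 \<Longrightarrow> power_series ?a z = k (cnj z) * power_series ?b z"
      "\<And>z. cmod z = 1 \<Longrightarrow> cmod (k z) \<le> 1"
      by (rule quotient_near_infinity[OF power_series_holomorphic[OF ca] power_series_holomorphic[OF cb]]) blast+
    have le': "circle_mean_square (\<lambda>j. ?a (j + n)) \<le> circle_mean_square (\<lambda>j. ?b (j + n))"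
      by (rule circle_mean_square_tail_le[OF ca cb k(1) _ k(2,3)]) (use r \<open>R > 0\<close> in auto)
    have sa: "(\<lambda>j. (cmod (?a (j + n)))\<^sup>2) sums circle_mean_square (\<lambda>j. ?a (j + n))"
      by (intro parseval_sums everywhere_convergent_shift ca)
    have sb: "(\<lambda>j. (cmod (?b (j + n)))\<^sup>2) sums circle_mean_square (\<lambda>j. ?b (j + n))"
      by (intro parseval_sums everywhere_convergent_shift cb)
    have "(\<Sum>j\<in>{n..<N}. (cmod (a j))\<^sup>2 * (r\<^sup>2) ^ j) = (\<Sum>j<N - n. (cmod (?a (j + n)))\<^sup>2)"
      unfolding cmod_coeff_scale_square by (rule sum.reindex_bij_witness[of _ "\<lambda>j. j + n" "\<lambda>j. j - n"]) auto
    also have "\<dots> \<le> (\<Sum>j. (cmod (?a (j + n)))\<^sup>2)"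
      by (rule sum_le_suminf[OF sums_summable[OF sa]]) auto
    also have "\<dots> \<le> (\<Sum>j. (cmod (?b (j + n)))\<^sup>2)"
      using le' by (simp only: sums_unique[OF sa, symmetric] sums_unique[OF sb, symmetric])
    finally show ?thesis unfolding cmod_coeff_scale_square .
  qed
  have summable: "summable (\<lambda>j. (cmod (b (j + n)))\<^sup>2 * x ^ j)" if "x \<ge> 0" for x
    by (rule summable_coeff_squares[OF everywhere_convergent_shift[OF b] that])
  have "isCont (\<lambda>x. \<Sum>j. (cmod (b (j + n)))\<^sup>2 * x ^ j) (R\<^sup>2)"
    by (rule isCont_powser[OF summable[of "R\<^sup>2 + 1"]]) auto
  hence "isCont (\<lambda>r. \<Sum>j. (cmod (b (j + n)))\<^sup>2 * (r\<^sup>2) ^ j) R"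
    by (rule isCont_o2[where f = "\<lambda>r. r\<^sup>2" and g = "\<lambda>x. \<Sum>j. (cmod (b (j + n)))\<^sup>2 * x ^ j" and a = R, rotated])
       (intro continuous_intros)
  hence c: "isCont (\<lambda>r. (r\<^sup>2) ^ n * (\<Sum>j. (cmod (b (j + n)))\<^sup>2 * (r\<^sup>2) ^ j)) R"
    by (intro continuous_intros)
  have pull: "(\<Sum>j. (cmod (b (j + n)))\<^sup>2 * (r\<^sup>2) ^ (j + n)) =
      (r\<^sup>2) ^ n * (\<Sum>j. (cmod (b (j + n)))\<^sup>2 * (r\<^sup>2) ^ j)" for r :: real
    by (subst suminf_mult[OF summable, symmetric]) (simp_all add: power_add mult_ac)
  show ?thesis
  proof (rule tendsto_le[of "at_right R"])
    show "((\<lambda>r. \<Sum>j. (cmod (b (j + n)))\<^sup>2 * (r\<^sup>2) ^ (j + n)) \<longlongrightarrow> (\<Sum>j. (cmod (b (j + n)))\<^sup>2 * (R\<^sup>2) ^ (j + n))) (at_right R)"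
      unfolding pull by (rule tendsto_mono[OF at_le c[unfolded isCont_def]]) simp
    show "((\<lambda>r. \<Sum>j\<in>{n..<N}. (cmod (a j))\<^sup>2 * (r\<^sup>2) ^ j) \<longlongrightarrow> (\<Sum>j\<in>{n..<N}. (cmod (a j))\<^sup>2 * (R\<^sup>2) ^ j)) (at_right R)"
      by (intro tendsto_intros)
    show "\<forall>\<^sub>F r in at_right R. (\<Sum>j\<in>{n..<N}. (cmod (a j))\<^sup>2 * (r\<^sup>2) ^ j) \<le> (\<Sum>j. (cmod (b (j + n)))\<^sup>2 * (r\<^sup>2) ^ (j + n))"
      by (rule eventually_mono[OF eventually_at_right_less[of R]]) (rule *)
  qed auto
qed

section \<open>Area measure: rotations and radial functions\<close>

text \<open>Both measures agree on open boxes. This opens the plane to Fubini in the real and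
  imaginary parts.\<close>

lemma lborel_complex_eq:
  "(lborel :: complex measure) = distr (lborel \<Otimes>\<^sub>M lborel) borel (\<lambda>p. Complex (fst p) (snd p))"
proof (rule lborel_eqI)
  have m: "(\<lambda>p. Complex (fst p) (snd p)) \<in> borel_measurable (lborel \<Otimes>\<^sub>M lborel)"
    unfolding Complex_eq by measurable
  fix l u :: complex
  assume lu: "\<And>b. b \<in> Basis \<Longrightarrow> l \<bullet> b \<le> u \<bullet> b"
  have le: "Re l \<le> Re u" "Im l \<le> Im u"
    using lu[of 1] lu[of \<i>] by (simp_all add: Basis_complex_def)
  have "(\<lambda>p. Complex (fst p) (snd p)) -` box l u = {Re l<..<Re u} \<times> {Im l<..<Im u}"
    by (auto simp: box_def Basis_complex_def)
  hence "emeasure (distr (lborel \<Otimes>\<^sub>M lborel) borel (\<lambda>p. Complex (fst p) (snd p))) (box l u) =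
      emeasure (lborel \<Otimes>\<^sub>M lborel) ({Re l<..<Re u} \<times> {Im l<..<Im u})"
    by (simp add: emeasure_distr[OF m] space_pair_measure)
  also have "\<dots> = ennreal (Re u - Re l) * ennreal (Im u - Im l)"
    by (subst lborel.emeasure_pair_measure_Times) (simp_all add: le)
  finally show "emeasure (distr (lborel \<Otimes>\<^sub>M lborel) borel (\<lambda>p. Complex (fst p) (snd p))) (box l u) =
      (\<Prod>b\<in>Basis. (u - l) \<bullet> b)"
    by (simp add: Basis_complex_def le flip: ennreal_mult)
qed simp

lemma nn_integral_complex_iterated:
  assumes H: "H \<in> borel_measurable borel"
  shows "(\<integral>\<^sup>+z. H z \<partial>lborel) = (\<integral>\<^sup>+y. \<integral>\<^sup>+x. H (Complex x y) \<partial>lborel \<partial>lborel)"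
    and "(\<integral>\<^sup>+z. H z \<partial>lborel) = (\<integral>\<^sup>+x. \<integral>\<^sup>+y. H (Complex x y) \<partial>lborel \<partial>lborel)"
proof -
  have m: "(\<lambda>p. Complex (fst p) (snd p)) \<in> borel_measurable (lborel \<Otimes>\<^sub>M lborel)"
    unfolding Complex_eq by measurable
  have mH: "(\<lambda>p. H (Complex (fst p) (snd p))) \<in> borel_measurable (lborel \<Otimes>\<^sub>M lborel)"
    using measurable_compose[OF m H] .
  have eq: "(\<integral>\<^sup>+z. H z \<partial>lborel) = (\<integral>\<^sup>+p. H (Complex (fst p) (snd p)) \<partial>(lborel \<Otimes>\<^sub>M lborel))"
    by (subst lborel_complex_eq, subst nn_integral_distr[OF m]) (use H in simp_all)
  show "(\<integral>\<^sup>+z. H z \<partial>lborel) = (\<integral>\<^sup>+y. \<integral>\<^sup>+x. H (Complex x y) \<partial>lborel \<partial>lborel)"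
    using lborel_pair.nn_integral_snd[of "\<lambda>p. H (Complex (fst p) (snd p))"] mH by (simp add: eq)
  show "(\<integral>\<^sup>+z. H z \<partial>lborel) = (\<integral>\<^sup>+x. \<integral>\<^sup>+y. H (Complex x y) \<partial>lborel \<partial>lborel)"
    using lborel.nn_integral_fst[OF mH] by (simp add: eq)
qed

text \<open>With one coordinate held fixed, a shear is a translation of the other one, so the inner
  integral of Fubini does not change.\<close>

lemma nn_integral_shear:
  fixes H :: "complex \<Rightarrow> ennreal"
  assumes H: "H \<in> borel_measurable borel"
  shows "(\<integral>\<^sup>+z. H (z + of_real (a * Im z)) \<partial>lborel) = (\<integral>\<^sup>+z. H z \<partial>lborel)"
    and "(\<integral>\<^sup>+z. H (z + \<i> * of_real (a * Re z)) \<partial>lborel) = (\<integral>\<^sup>+z. H z \<partial>lborel)"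
proof -
  have mC: "(\<lambda>x. Complex x y) \<in> borel_measurable borel" "Complex x \<in> borel_measurable borel" for x y
    unfolding Complex_eq by measurable
  have c1: "continuous_on UNIV (\<lambda>z. z + of_real (a * Im z))"
    and c2: "continuous_on UNIV (\<lambda>z. z + \<i> * of_real (a * Re z))"
    by (intro continuous_intros)+
  have m1: "(\<lambda>z. H (z + of_real (a * Im z))) \<in> borel_measurable borel"
    using measurable_compose[OF borel_measurable_continuous_onI[OF c1] H] .
  have m2: "(\<lambda>z. H (z + \<i> * of_real (a * Re z))) \<in> borel_measurable borel"
    using measurable_compose[OF borel_measurable_continuous_onI[OF c2] H] .
  have e1: "Complex x y + of_real (a * Im (Complex x y)) = Complex (a * y + 1 * x) y" for x y
    by (simp add: complex_eq_iff)
  have e2: "Complex x y + \<i> * of_real (a * Re (Complex x y)) = Complex x (a * x + 1 * y)" for x y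
    by (simp add: complex_eq_iff)
  have i1: "(\<integral>\<^sup>+x. H (Complex (a * y + 1 * x) y) \<partial>lborel) = (\<integral>\<^sup>+x. H (Complex x y) \<partial>lborel)" for y
    using nn_integral_real_affine[OF measurable_compose[OF mC(1) H], of 1 y "a * y"] by simp
  have i2: "(\<integral>\<^sup>+y. H (Complex x (a * x + 1 * y)) \<partial>lborel) = (\<integral>\<^sup>+y. H (Complex x y) \<partial>lborel)" for x
    using nn_integral_real_affine[OF measurable_compose[OF mC(2) H], of 1 x "a * x"] by simp
  show "(\<integral>\<^sup>+z. H (z + of_real (a * Im z)) \<partial>lborel) = (\<integral>\<^sup>+z. H z \<partial>lborel)"
    unfolding nn_integral_complex_iterated(1)[OF m1] nn_integral_complex_iterated(1)[OF H] e1 i1 ..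
  show "(\<integral>\<^sup>+z. H (z + \<i> * of_real (a * Re z)) \<partial>lborel) = (\<integral>\<^sup>+z. H z \<partial>lborel)"
    unfolding nn_integral_complex_iterated(2)[OF m2] nn_integral_complex_iterated(2)[OF H] e2 i2 ..
qed

text \<open>A rotation other than the half turn is a product of three shears.\<close>

lemma nn_integral_rotation:
  fixes H :: "complex \<Rightarrow> ennreal"
  assumes H: "H \<in> borel_measurable borel" and u: "cmod u = 1"
  shows "(\<integral>\<^sup>+z. H (u * z) \<partial>lborel) = (\<integral>\<^sup>+z. H z \<partial>lborel)"
proof -
  have m: "(\<lambda>z. H (v * z)) \<in> borel_measurable borel" for v
    by (rule measurable_compose[OF _ H]) (intro borel_measurable_continuous_onI continuous_intros)
  have *: "(\<integral>\<^sup>+z. H (v * z) \<partial>lborel) = (\<integral>\<^sup>+z. H z \<partial>lborel)"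
    if H: "H \<in> borel_measurable borel" and v: "cmod v = 1" "Re v \<noteq> -1" for v and H :: "complex \<Rightarrow> ennreal"
  proof -
    define s where "s = Im v"
    \<comment> \<open>For v = cis x this is - tan (x / 2), and \<open>s\<close> is sin x: the
      classical factors of a rotation into shears. The denominator vanishes exactly at the half
      turn.\<close>
    define a where "a = - s / (1 + Re v)"
    let ?X = "\<lambda>z. z + of_real (a * Im z)" and ?Y = "\<lambda>z. z + \<i> * of_real (s * Re z)"
    have nz: "1 + Re v \<noteq> 0" using v(2) by linarith
    have sq: "s * s = (1 - Re v) * (1 + Re v)"
      using v(1) cmod_power2[of v] by (simp add: s_def power2_eq_square algebra_simps)
    have "a * s = - (s * s) / (1 + Re v)" by (simp add: a_def)
    hence as: "a * s = Re v - 1" using nz by (simp add: sq)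
    have aa: "a + (a + a * s * a) = - s"
    proof -
      have "a + (a + a * s * a) = a * (1 + Re v)" unfolding as by (simp add: algebra_simps)
      thus ?thesis using nz by (simp add: a_def)
    qed
    have vz: "v * z = ?X (?Y (?X z))" for z
    proof (rule complex_eqI)
      have "Re (?X (?Y (?X z))) = (1 + a * s) * Re z + (a + (a + a * s * a)) * Im z"
        by (simp add: algebra_simps)
      also have "\<dots> = Re v * Re z - s * Im z" unfolding aa by (simp add: as)
      finally show "Re (v * z) = Re (?X (?Y (?X z)))" by (simp add: s_def)
      have "Im (?X (?Y (?X z))) = s * Re z + (1 + a * s) * Im z"
        by (simp add: algebra_simps)
      also have "\<dots> = s * Re z + Re v * Im z" by (simp add: as)
      finally show "Im (v * z) = Im (?X (?Y (?X z)))" by (simp add: s_def)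
    qed
    have cX: "?X \<in> borel_measurable borel" and cY: "?Y \<in> borel_measurable borel"
      by (intro borel_measurable_continuous_onI continuous_intros)+
    have "(\<integral>\<^sup>+z. H (v * z) \<partial>lborel) = (\<integral>\<^sup>+z. (\<lambda>z. H (?X (?Y z))) (?X z) \<partial>lborel)"
      unfolding vz ..
    also have "\<dots> = (\<integral>\<^sup>+z. (\<lambda>z. H (?X z)) (?Y z) \<partial>lborel)"
      by (rule nn_integral_shear(1)) (rule measurable_compose[OF cY measurable_compose[OF cX H]])
    also have "\<dots> = (\<integral>\<^sup>+z. H (?X z) \<partial>lborel)"
      by (rule nn_integral_shear(2)) (rule measurable_compose[OF cX H])
    also have "\<dots> = (\<integral>\<^sup>+z. H z \<partial>lborel)"
      by (rule nn_integral_shear(1)[OF H])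
    finally show ?thesis .
  qed
  show ?thesis
  proof (cases "Re u = -1")
    case False
    with *[OF H u] show ?thesis by simp
  next
    case True
    with u cmod_power2[of u] have "Im u = 0" by simp
    \<comment> \<open>The half turn is two quarter turns, each covered by the case already
      treated.\<close>
    with True have "u = \<i> * \<i>" by (simp add: complex_eq_iff)
    hence "(\<integral>\<^sup>+z. H (u * z) \<partial>lborel) = (\<integral>\<^sup>+z. (\<lambda>z. H (\<i> * z)) (\<i> * z) \<partial>lborel)"
      by (simp only: mult.assoc)
    also have "\<dots> = (\<integral>\<^sup>+z. H z \<partial>lborel)"
      by (subst *[OF m]) (simp, simp, subst *[OF H], simp_all)
    finally show ?thesis .
  qed
qed

text \<open>The disc of radius sqrt a has area pi a, and half-lines generate the Borel sets. This
  takes the place of polar coordinates, and it is where the factor pi in the norm comes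
  from.\<close>

lemma distr_cmod_square:
  "distr lborel borel (\<lambda>z. (cmod z)\<^sup>2) = density lborel (\<lambda>t. ennreal pi * indicator {0..} t)"
proof (rule measure_eqI_generator_eq)
  let ?E = "range (\<lambda>a::real. {..a})"
  show "Int_stable ?E" by (auto simp: Int_stable_def)
  show "?E \<subseteq> Pow UNIV" by simp
  show "sets (distr lborel borel (\<lambda>z. (cmod z)\<^sup>2)) = sigma_sets UNIV ?E"
    "sets (density lborel (\<lambda>t. ennreal pi * indicator {0..} t)) = sigma_sets UNIV ?E"
    by (simp_all add: borel_eq_atMost)
  have val: "emeasure (distr lborel borel (\<lambda>z. (cmod z)\<^sup>2)) {..a} = ennreal pi * ennreal (max 0 a)" for a
  proof -
    have "(\<lambda>z. (cmod z)\<^sup>2) -` {..a} = (if a \<ge> 0 then cball 0 (sqrt a) else {})"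
      using real_le_rsqrt real_sqrt_ge_zero
      by (auto simp: dist_norm intro: real_le_rsqrt dest: order_trans[OF zero_le_power2] sqrt_ge_absD)
         (metis norm_ge_zero power_mono real_sqrt_pow2)
    thus ?thesis
      by (auto simp: emeasure_distr emeasure_cball unit_ball_vol_2 max_def ennreal_mult)
  qed
  show "emeasure (distr lborel borel (\<lambda>z. (cmod z)\<^sup>2)) X =
      emeasure (density lborel (\<lambda>t. ennreal pi * indicator {0..} t)) X" if X: "X \<in> ?E" for X
  proof -
    obtain a where X: "X = {..a}" using X by auto
    have "emeasure (density lborel (\<lambda>t. ennreal pi * indicator {0..} t)) {..a} =
        (\<integral>\<^sup>+t. ennreal pi * indicator {0..a} t \<partial>lborel)"
      by (subst emeasure_density) (auto intro!: nn_integral_cong split: split_indicator)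
    also have "\<dots> = ennreal pi * ennreal (max 0 a)"
      by (subst nn_integral_cmult_indicator) (auto simp: max_def)
    finally show ?thesis unfolding X val ..
  qed
  let ?A = "\<lambda>n::nat. {..real n}"
  show "range ?A \<subseteq> ?E" by auto
  show "(\<Union>i. ?A i) = UNIV" by (auto intro: real_arch_simple)
  show "emeasure (distr lborel borel (\<lambda>z. (cmod z)\<^sup>2)) (?A i) \<noteq> \<infinity>" for i
    unfolding val by (simp add: ennreal_mult_eq_top_iff)
qed

lemma nn_integral_cmod_square:
  assumes [measurable]: "h \<in> borel_measurable borel"
  shows "(\<integral>\<^sup>+z. h ((cmod z)\<^sup>2) \<partial>lborel) = ennreal pi * (\<integral>\<^sup>+t\<in>{0..}. h t \<partial>lborel)"
proof -
  have "(\<integral>\<^sup>+z. h ((cmod z)\<^sup>2) \<partial>lborel) = (\<integral>\<^sup>+t. h t \<partial>distr lborel borel (\<lambda>z::complex. (cmod z)\<^sup>2))"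
    by (subst nn_integral_distr) auto
  also have "\<dots> = (\<integral>\<^sup>+t. ennreal pi * (h t * indicator {0..} t) \<partial>lborel)"
    unfolding distr_cmod_square
    by (subst nn_integral_density) (auto intro!: nn_integral_cong simp: mult_ac)
  also have "\<dots> = ennreal pi * (\<integral>\<^sup>+t\<in>{0..}. h t \<partial>lborel)"
    by (rule nn_integral_cmult) measurable
  finally show ?thesis .
qed

lemma nn_integral_unit_circle:
  assumes a: "everywhere_convergent a"
  shows "(\<integral>\<^sup>+t\<in>{0..1}. ennreal ((cmod (power_series a (cis (2 * pi * t) * z)))\<^sup>2) \<partial>lborel) =
    (\<Sum>k. ennreal ((cmod (a k))\<^sup>2) * ennreal ((cmod z)\<^sup>2) ^ k)"
proof -
  let ?b = "\<lambda>k. a k * z ^ k"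
  have b: "everywhere_convergent ?b" by (rule everywhere_convergent_scale[OF a])
  have "continuous_on (cball 0 1) (power_series ?b)"
    by (intro holomorphic_on_imp_continuous_on power_series_holomorphic b)
  hence "(\<lambda>t::real. (cmod (power_series ?b (cis (2 * pi * t))))\<^sup>2) integrable_on {0..1}"
    by (intro integrable_continuous_real continuous_intros continuous_on_compose_unit_circle)
  hence "((\<lambda>t::real. (cmod (power_series ?b (cis (2 * pi * t))))\<^sup>2) has_integral circle_mean_square ?b) {0..1}"
    unfolding circle_mean_square_def by (rule integrable_integral)
  hence "(\<integral>\<^sup>+t. ennreal (indicator {0..1} t * (cmod (power_series ?b (cis (2 * pi * t))))\<^sup>2) \<partial>lborel) =
      ennreal (circle_mean_square ?b)"
    by (intro nn_integral_has_integral_lebesgue) simp_all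
  moreover have "ennreal (indicator {0..1} t * c) = ennreal c * indicator {0..1} t" for t c :: real
    by (simp split: split_indicator)
  ultimately have 1: "(\<integral>\<^sup>+t\<in>{0..1}. ennreal ((cmod (power_series ?b (cis (2 * pi * t))))\<^sup>2) \<partial>lborel) = ennreal (circle_mean_square ?b)"
    by (simp only:)
  have "(\<Sum>k. ennreal ((cmod (?b k))\<^sup>2)) = ennreal (circle_mean_square ?b)"
    by (rule suminf_ennreal_eq[OF _ parseval_sums[OF b]]) simp
  moreover have "ennreal ((cmod (?b k))\<^sup>2) = ennreal ((cmod (a k))\<^sup>2) * ennreal ((cmod z)\<^sup>2) ^ k" for k
  proof -
    have "(cmod z ^ k)\<^sup>2 = ((cmod z)\<^sup>2) ^ k" by (simp only: mult.commute flip: power_mult)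
    hence "(cmod (?b k))\<^sup>2 = (cmod (a k))\<^sup>2 * ((cmod z)\<^sup>2) ^ k"
      by (simp only: norm_mult norm_power power_mult_distrib)
    thus ?thesis by (simp only: ennreal_mult ennreal_power zero_le_power2 zero_le_power)
  qed
  ultimately show ?thesis
    using 1 by (simp only: power_series_scale mult.commute[of z])
qed

text \<open>The factor \<open>V\<close> is unchanged by rotations, so the integral equals its
  average over all rotations. By Tonelli the average moves inside, Parseval makes the integrand
  radial, and \<open>nn_integral_cmod_square\<close> reduces each term to the half-line. Working in
  \<open>ennreal\<close> keeps all exchanges free of integrability questions.\<close>

lemma nn_integral_radial_weight:
  assumes a: "everywhere_convergent a" and V[measurable]: "V \<in> borel_measurable borel"
  shows "(\<integral>\<^sup>+z. ennreal ((cmod (power_series a z))\<^sup>2) * V ((cmod z)\<^sup>2) \<partial>lborel) =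
    ennreal pi * (\<Sum>k. ennreal ((cmod (a k))\<^sup>2) * (\<integral>\<^sup>+t\<in>{0..}. ennreal t ^ k * V t \<partial>lborel))"
proof -
  let ?F = "\<lambda>z. ennreal ((cmod (power_series a z))\<^sup>2)"
  have "continuous_on UNIV (power_series a)"
    by (intro holomorphic_on_imp_continuous_on power_series_holomorphic a)
  hence [measurable]: "power_series a \<in> borel_measurable borel"
    by (rule borel_measurable_continuous_onI)
  have [measurable]: "cis \<in> borel_measurable borel"
    by (intro borel_measurable_continuous_onI continuous_intros)
  let ?I = "\<integral>\<^sup>+z. ?F z * V ((cmod z)\<^sup>2) \<partial>lborel"
  have rot: "(\<integral>\<^sup>+z. ?F (cis (2 * pi * t) * z) * V ((cmod z)\<^sup>2) \<partial>lborel) = ?I" for t :: real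
  proof -
    have "(\<lambda>z. ?F z * V ((cmod z)\<^sup>2)) \<in> borel_measurable borel" by measurable
    from nn_integral_rotation[OF this, of "cis (2 * pi * t)"] show ?thesis by (simp add: norm_mult)
  qed
  have "?I = (\<integral>\<^sup>+t\<in>{0..1::real}. ?I \<partial>lborel)"
    by (subst nn_integral_cmult_indicator) auto
  also have "\<dots> = (\<integral>\<^sup>+t\<in>{0..1}. (\<integral>\<^sup>+z. ?F (cis (2 * pi * t) * z) * V ((cmod z)\<^sup>2) \<partial>lborel) \<partial>lborel)"
    by (simp only: rot)
  also have "\<dots> = (\<integral>\<^sup>+t. (\<integral>\<^sup>+z. ?F (cis (2 * pi * t) * z) * V ((cmod z)\<^sup>2) * indicator {0..1} t \<partial>lborel) \<partial>lborel)"
    by (intro nn_integral_cong nn_integral_multc[symmetric]) measurable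
  also have "\<dots> = (\<integral>\<^sup>+z. (\<integral>\<^sup>+t. ?F (cis (2 * pi * t) * z) * V ((cmod z)\<^sup>2) * indicator {0..1} t \<partial>lborel) \<partial>lborel)"
    by (rule lborel_pair.Fubini'[symmetric]) measurable
  also have "\<dots> = (\<integral>\<^sup>+z. (\<integral>\<^sup>+t\<in>{0..1}. ?F (cis (2 * pi * t) * z) \<partial>lborel) * V ((cmod z)\<^sup>2) \<partial>lborel)"
    by (intro nn_integral_cong, subst nn_integral_multc[symmetric]) (measurable, auto intro!: nn_integral_cong simp: mult_ac)
  also have "\<dots> = (\<integral>\<^sup>+z. (\<Sum>k. ennreal ((cmod (a k))\<^sup>2) * (ennreal ((cmod z)\<^sup>2) ^ k * V ((cmod z)\<^sup>2))) \<partial>lborel)"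
    unfolding nn_integral_unit_circle[OF a] by (simp add: mult.assoc flip: ennreal_suminf_multc)
  also have "\<dots> = (\<Sum>k. \<integral>\<^sup>+z. ennreal ((cmod (a k))\<^sup>2) * (ennreal ((cmod z)\<^sup>2) ^ k * V ((cmod z)\<^sup>2)) \<partial>lborel)"
    by (rule nn_integral_suminf) measurable
  also have "\<dots> = (\<Sum>k. ennreal pi * (ennreal ((cmod (a k))\<^sup>2) * (\<integral>\<^sup>+t\<in>{0..}. ennreal t ^ k * V t \<partial>lborel)))"
  proof (intro suminf_cong)
    fix k
    have "(\<integral>\<^sup>+z. ennreal ((cmod (a k))\<^sup>2) * (ennreal ((cmod z)\<^sup>2) ^ k * V ((cmod z)\<^sup>2)) \<partial>(lborel :: complex measure)) =
        ennreal ((cmod (a k))\<^sup>2) * (\<integral>\<^sup>+z. (\<lambda>t. ennreal t ^ k * V t) ((cmod z)\<^sup>2) \<partial>(lborel :: complex measure))"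
      by (rule nn_integral_cmult) measurable
    also have "\<dots> = ennreal ((cmod (a k))\<^sup>2) * (ennreal pi * (\<integral>\<^sup>+t\<in>{0..}. ennreal t ^ k * V t \<partial>lborel))"
      by (subst nn_integral_cmod_square) simp_all
    finally show "(\<integral>\<^sup>+z. ennreal ((cmod (a k))\<^sup>2) * (ennreal ((cmod z)\<^sup>2) ^ k * V ((cmod z)\<^sup>2)) \<partial>(lborel :: complex measure)) =
        ennreal pi * (ennreal ((cmod (a k))\<^sup>2) * (\<integral>\<^sup>+t\<in>{0..}. ennreal t ^ k * V t \<partial>lborel))"
      by (simp add: mult_ac)
  qed
  finally show ?thesis by simp
qed

section \<open>Taylor coefficients, Abel summation, and null sets under the squared modulus\<close>

lemma entire_power_series:
  assumes "f holomorphic_on UNIV"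
  obtains a where "everywhere_convergent a" "f = power_series a"
proof
  let ?a = "\<lambda>k. (deriv ^^ k) f 0 / fact k"
  have sums: "(\<lambda>k. ?a k * z ^ k) sums f z" for z
    using holomorphic_power_series[of f 0 "cmod z + 1" z] assms
    by (auto intro: holomorphic_on_subset)
  thus "everywhere_convergent ?a"
    unfolding everywhere_convergent_def using sums_summable by blast
  show "f = power_series ?a"
    unfolding power_series_def using sums sums_unique by blast
qed

text \<open>Abel summation in the form of a double sum: interchanging the order turns the sum of
  \<gamma> k * w k into the sum over n of d n times the n-th tail of \<gamma>. That \<open>w\<close>
  is nondecreasing is encoded in the type of its increments \<open>d\<close>.\<close>

lemma suminf_abel_le:
  fixes \<alpha> \<beta> w d :: "nat \<Rightarrow> ennreal"
  assumes w: "\<And>k. w k = (\<Sum>n\<le>k. d n)"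
    and tails: "\<And>n. (\<Sum>k. if n \<le> k then \<alpha> k else 0) \<le> (\<Sum>k. if n \<le> k then \<beta> k else 0)"
  shows "(\<Sum>k. \<alpha> k * w k) \<le> (\<Sum>k. \<beta> k * w k)"
proof -
  \<comment> \<open>Tonelli for two counting measures.\<close>
  have swap: "(\<Sum>i. \<Sum>j. h i j) = (\<Sum>j. \<Sum>i. h i j)" for h :: "nat \<Rightarrow> nat \<Rightarrow> ennreal"
    using nn_integral_suminf[of "\<lambda>j i. h i j" "count_space UNIV"]
    by (simp add: nn_integral_count_space_nat)
  have eq: "(\<Sum>k. \<gamma> k * w k) = (\<Sum>n. d n * (\<Sum>k. if n \<le> k then \<gamma> k else 0))" for \<gamma> :: "nat \<Rightarrow> ennreal"
  proof -
    have "\<gamma> k * w k = (\<Sum>n. if n \<le> k then \<gamma> k * d n else 0)" for k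
    proof -
      have "(\<Sum>n. if n \<le> k then \<gamma> k * d n else 0) = (\<Sum>n\<le>k. if n \<le> k then \<gamma> k * d n else 0)"
        by (rule suminf_finite) auto
      thus ?thesis unfolding w by (simp add: sum_distrib_left)
    qed
    hence "(\<Sum>k. \<gamma> k * w k) = (\<Sum>k. \<Sum>n. if n \<le> k then \<gamma> k * d n else 0)"
      by (simp only:)
    also have "\<dots> = (\<Sum>n. \<Sum>k. if n \<le> k then \<gamma> k * d n else 0)"
      by (rule swap)
    also have "\<dots> = (\<Sum>n. \<Sum>k. d n * (if n \<le> k then \<gamma> k else 0))"
      by (intro suminf_cong) (simp add: mult.commute)
    finally show ?thesis by (simp only: ennreal_suminf_cmult)
  qed
  show ?thesis
    unfolding eq by (intro suminf_le mult_left_mono tails) auto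
qed

text \<open>The image of area measure under |z|^2 has a density, so preimages of null sets are
  null.\<close>

lemma AE_cmod_square:
  assumes "AE t in lborel. P t"
  shows "AE z in (lborel :: complex measure). P ((cmod z)\<^sup>2)"
proof -
  have "AE t in distr lborel borel (\<lambda>z::complex. (cmod z)\<^sup>2). P t"
    unfolding distr_cmod_square using assms by (subst AE_density) auto
  thus ?thesis
    by (rule AE_distrD[rotated]) measurable
qed

text \<open>A Lebesgue measurable weight may be composed only with maps that pull null sets back to
  null sets; Borel measurability of |z|^2 alone would not do.\<close>

lemma measurable_cmod_square_lebesgue:
  "(\<lambda>z::complex. (cmod z)\<^sup>2) \<in> lebesgue \<rightarrow>\<^sub>M lebesgue"
proof (rule completion.measurable_completion2)
  show m: "(\<lambda>z::complex. (cmod z)\<^sup>2) \<in> lebesgue \<rightarrow>\<^sub>M lborel"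
    by (rule measurable_completion) measurable
  show "null_sets lborel \<subseteq> null_sets (distr lebesgue lborel (\<lambda>z::complex. (cmod z)\<^sup>2))"
  proof
    fix N :: "real set" assume N: "N \<in> null_sets lborel"
    hence "AE t in lborel. t \<notin> N" by (rule AE_not_in)
    from AE_completion[OF AE_cmod_square[OF this]] have "AE z in lebesgue. (cmod (z::complex))\<^sup>2 \<notin> N" .
    moreover have "N \<in> sets lborel" using N by (simp add: null_sets_def)
    from measurable_sets[OF m this] have "{z::complex \<in> space lebesgue. (cmod z)\<^sup>2 \<in> N} \<in> sets lebesgue"
      by (simp add: vimage_def)
    ultimately have "emeasure lebesgue {z::complex \<in> space lebesgue. (cmod z)\<^sup>2 \<in> N} = 0"
      by (subst (asm) AE_iff_measurable[OF _ refl]) auto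
    thus "N \<in> null_sets (distr lebesgue lborel (\<lambda>z::complex. (cmod z)\<^sup>2))"
      using N m by (auto simp: null_sets_def emeasure_distr vimage_def)
  qed
qed

section \<open>The weighted norm in terms of moments, and the Korenblum radius\<close>

context
  fixes W :: "real \<Rightarrow> real"
  assumes W: "radial_weight W"
begin

lemma radial_weight_measurable: "(\<lambda>t. indicator {0..} t * W t) \<in> borel_measurable lebesgue"
  using W by (simp add: radial_weight_def set_borel_measurable_def)

lemma radial_weight_nonneg: "t \<ge> 0 \<Longrightarrow> W t \<ge> 0"
  using W by (simp add: radial_weight_def)

lemma radial_weight_integrable: "integrable lebesgue (\<lambda>t. indicator {0..} t * (t ^ k * W t))"
  using W by (simp add: radial_weight_def set_integrable_def)

lemma weight_moment_eq: "weight_moment W k = (LINT t|lebesgue. indicator {0..} t * (t ^ k * W t))"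
  by (simp add: weight_moment_def set_lebesgue_integral_def)

lemma weight_moment_nonneg: "weight_moment W k \<ge> 0"
  unfolding weight_moment_eq
  by (rule Bochner_Integration.integral_nonneg) (auto simp: radial_weight_nonneg split: split_indicator)

lemma weight_moment_1_pos: "weight_moment W 1 > 0"
proof (rule ccontr)
  assume "\<not> weight_moment W 1 > 0"
  hence "weight_moment W 1 = 0" using weight_moment_nonneg[of 1] by simp
  hence "AE t in lebesgue. indicator {0..} t * (t ^ 1 * W t) = 0"
    unfolding weight_moment_eq
    by (subst (asm) integral_nonneg_eq_0_iff_AE[OF radial_weight_integrable])
       (auto simp: radial_weight_nonneg split: split_indicator)
  moreover have "AE t in lebesgue. t \<noteq> (0::real)"
    by (intro AE_completion AE_lborel_singleton)
  ultimately have "AE t in lebesgue. t \<ge> 0 \<longrightarrow> W t = 0"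
    by eventually_elim (auto split: split_indicator_asm)
  thus False using W by (simp add: radial_weight_def)
qed

text \<open>Chebyshev's inequality: t^k - s^k and t - s have the same sign on the half-line. Total
  mass 1 makes the integral of (t - s) W vanish, which removes the term with the factor s^k.\<close>

lemma weight_moment_Suc_ge:
  assumes "weight_moment W 0 = 1"
  shows "weight_moment W 1 * weight_moment W k \<le> weight_moment W (Suc k)"
proof -
  define s where "s = weight_moment W 1"
  let ?i = "\<lambda>k t. indicator {0..} t * (t ^ k * W t)"
  have s: "s \<ge> 0" using weight_moment_1_pos by (simp add: s_def)
  have "s ^ k * (LINT t|lebesgue. ?i 1 t - s * ?i 0 t) \<le> (LINT t|lebesgue. ?i (Suc k) t - s * ?i k t)"
    unfolding integral_mult_right_zero[symmetric]
  proof (rule integral_mono)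
    fix t :: real
    show "s ^ k * (?i 1 t - s * ?i 0 t) \<le> ?i (Suc k) t - s * ?i k t"
    proof (cases "t \<ge> 0")
      case True
      have "0 \<le> (t ^ k - s ^ k) * (t - s)"
      proof (cases "s \<le> t")
        case st: True
        thus ?thesis using power_mono[OF st s, of k] by (intro mult_nonneg_nonneg) simp_all
      next
        case False
        thus ?thesis using power_mono[OF _ True, of s k] by (intro mult_nonpos_nonpos) simp_all
      qed
      hence "0 \<le> (t ^ k - s ^ k) * (t - s) * W t"
        using radial_weight_nonneg[OF True] by (rule mult_nonneg_nonneg)
      thus ?thesis using True by (simp add: algebra_simps)
    qed simp
  qed (intro Bochner_Integration.integrable_diff integrable_mult_right radial_weight_integrable)+
  moreover have "(LINT t|lebesgue. ?i (Suc j) t - s * ?i j t) = weight_moment W (Suc j) - s * weight_moment W j" for j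
    unfolding weight_moment_eq
    by (subst Bochner_Integration.integral_diff)
       (intro integrable_mult_right radial_weight_integrable, intro integrable_mult_right radial_weight_integrable, simp only: integral_mult_right_zero)
  from this[of 0] this[of k] have
    "(LINT t|lebesgue. ?i 1 t - s * ?i 0 t) = 0" 
    "(LINT t|lebesgue. ?i (Suc k) t - s * ?i k t) = weight_moment W (Suc k) - s * weight_moment W k"
    using assms by (simp_all add: s_def)
  ultimately show ?thesis by (simp add: s_def)
qed

text \<open>Needed for the push-forward and Tonelli arguments over \<open>lborel\<close>. A Borel
  function equal to W almost everywhere might be negative on a null set; its positive part is
  nonnegative everywhere.\<close>

lemma borel_version:
  obtains V where "V \<in> borel_measurable borel" "\<And>t. V t \<ge> 0"
    "AE t in lborel. indicator {0..} t * W t = V t"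
proof -
  obtain V where V: "V \<in> borel_measurable lborel" "AE t in lborel. indicator {0..} t * W t = V t"
    using completion_ex_borel_measurable_real[OF radial_weight_measurable] by blast
  show thesis
  proof
    show "(\<lambda>t. max 0 (V t)) \<in> borel_measurable borel" using V(1) by simp
    show "AE t in lborel. indicator {0..} t * W t = max 0 (V t)"
      using V(2)
    proof eventually_elim
      fix t assume "indicator {0..} t * W t = V t"
      moreover have "0 \<le> indicator {0..} t * W t"
        by (simp add: radial_weight_nonneg split: split_indicator)
      ultimately show "indicator {0..} t * W t = max 0 (V t)" by simp
    qed
  qed simp
qed

lemma nn_integral_fock:
  assumes a: "everywhere_convergent a"
  shows "(\<integral>\<^sup>+z. ennreal ((cmod (power_series a z))\<^sup>2 * W ((cmod z)\<^sup>2)) \<partial>lebesgue) =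
    ennreal pi * (\<Sum>k. ennreal ((cmod (a k))\<^sup>2) * ennreal (weight_moment W k))"
proof -
  obtain V where V[measurable]: "V \<in> borel_measurable borel" and V0: "\<And>t. V t \<ge> 0"
    and AE: "AE t in lborel. indicator {0..} t * W t = V t"
    using borel_version by blast
  have m: "(\<integral>\<^sup>+t\<in>{0..}. ennreal t ^ k * ennreal (V t) \<partial>lborel) = ennreal (weight_moment W k)" for k
  proof -
    have "(\<integral>\<^sup>+t\<in>{0..}. ennreal t ^ k * ennreal (V t) \<partial>lborel) =
        (\<integral>\<^sup>+t. ennreal (indicator {0..} t * (t ^ k * W t)) \<partial>lborel)"
    proof (rule nn_integral_cong_AE)
      show "AE t in lborel. ennreal t ^ k * ennreal (V t) * indicator {0..} t =
          ennreal (indicator {0..} t * (t ^ k * W t))"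
        using AE
      proof eventually_elim
        fix t assume "indicator {0..} t * W t = V t"
        thus "ennreal t ^ k * ennreal (V t) * indicator {0..} t = ennreal (indicator {0..} t * (t ^ k * W t))"
          using V0[of t] by (cases "t \<ge> 0") (simp_all add: ennreal_mult ennreal_power)
      qed
    qed
    also have "\<dots> = (\<integral>\<^sup>+t. ennreal (indicator {0..} t * (t ^ k * W t)) \<partial>lebesgue)"
      by (simp add: nn_integral_completion)
    also have "\<dots> = ennreal (weight_moment W k)"
      unfolding weight_moment_eq
      by (rule nn_integral_eq_integral[OF radial_weight_integrable])
         (auto simp: radial_weight_nonneg split: split_indicator)
    finally show ?thesis .
  qed
  have "(\<integral>\<^sup>+z. ennreal ((cmod (power_series a z))\<^sup>2 * W ((cmod z)\<^sup>2)) \<partial>lebesgue) =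
      (\<integral>\<^sup>+z. ennreal ((cmod (power_series a z))\<^sup>2) * ennreal (V ((cmod z)\<^sup>2)) \<partial>lborel)"
    unfolding nn_integral_completion
  proof (rule nn_integral_cong_AE)
    show "AE z in lborel. ennreal ((cmod (power_series a z))\<^sup>2 * W ((cmod z)\<^sup>2)) =
        ennreal ((cmod (power_series a z))\<^sup>2) * ennreal (V ((cmod z)\<^sup>2))"
      using AE_cmod_square[OF AE] by eventually_elim (simp add: ennreal_mult')
  qed
  also have "\<dots> = ennreal pi * (\<Sum>k. ennreal ((cmod (a k))\<^sup>2) * ennreal (weight_moment W k))"
    using nn_integral_radial_weight[OF a, of "\<lambda>t. ennreal (V t)"] by (simp add: m)
  finally show ?thesis .
qed

lemma fock_integrand_measurable:
  assumes a: "everywhere_convergent a"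
  shows "(\<lambda>z. (cmod (power_series a z))\<^sup>2 * W ((cmod z)\<^sup>2)) \<in> borel_measurable lebesgue"
proof -
  have "continuous_on UNIV (power_series a)"
    by (intro holomorphic_on_imp_continuous_on power_series_holomorphic a)
  hence "power_series a \<in> borel_measurable lebesgue"
    by (intro measurable_completion) (simp add: borel_measurable_continuous_onI)
  moreover have "(\<lambda>z::complex. W ((cmod z)\<^sup>2)) \<in> borel_measurable lebesgue"
    using measurable_compose[OF measurable_cmod_square_lebesgue radial_weight_measurable] by simp
  ultimately show ?thesis by measurable
qed

lemma power_series_in_fock_space_iff:
  assumes a: "everywhere_convergent a"
  shows "power_series a \<in> fock_space W \<longleftrightarrow>
    (\<Sum>k. ennreal ((cmod (a k))\<^sup>2) * ennreal (weight_moment W k)) < \<infinity>"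
proof -
  have "power_series a \<in> fock_space W \<longleftrightarrow>
      (\<integral>\<^sup>+z. ennreal (norm ((cmod (power_series a z))\<^sup>2 * W ((cmod z)\<^sup>2))) \<partial>lebesgue) < \<infinity>"
    unfolding fock_space_def integrable_iff_bounded
    using fock_integrand_measurable[OF a] power_series_holomorphic[OF a] by simp
  also have "\<dots> \<longleftrightarrow> (\<integral>\<^sup>+z. ennreal ((cmod (power_series a z))\<^sup>2 * W ((cmod z)\<^sup>2)) \<partial>lebesgue) < \<infinity>"
    by (simp add: abs_mult radial_weight_nonneg)
  also have "\<dots> \<longleftrightarrow> (\<Sum>k. ennreal ((cmod (a k))\<^sup>2) * ennreal (weight_moment W k)) < \<infinity>"
    unfolding nn_integral_fock[OF a] by (auto simp: ennreal_mult_less_top)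
  finally show ?thesis .
qed

lemma fock_norm_power_series:
  assumes a: "everywhere_convergent a"
  shows "fock_norm W (power_series a) =
    sqrt (enn2real (\<Sum>k. ennreal ((cmod (a k))\<^sup>2) * ennreal (weight_moment W k)))"
proof -
  have "(LINT z|lebesgue. (cmod (power_series a z))\<^sup>2 * W ((cmod z)\<^sup>2)) =
      enn2real (\<integral>\<^sup>+z. ennreal ((cmod (power_series a z))\<^sup>2 * W ((cmod z)\<^sup>2)) \<partial>lebesgue)"
    by (rule integral_eq_nn_integral[OF fock_integrand_measurable[OF a]])
       (simp add: radial_weight_nonneg)
  thus ?thesis
    unfolding fock_norm_def nn_integral_fock[OF a] by (simp add: enn2real_mult)
qed

text \<open>Supplies the constant and the linear test function that bound the admissible radii from
  above.\<close>

lemma fock_norm_monomial: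
  "power_series (\<lambda>k. if k = n then c else 0) z = c * z ^ n"
  "power_series (\<lambda>k. if k = n then c else 0) \<in> fock_space W"
  "fock_norm W (power_series (\<lambda>k. if k = n then c else 0)) = cmod c * sqrt (weight_moment W n)"
proof -
  let ?a = "\<lambda>k. if k = n then c else 0"
  have sums: "(\<lambda>k. ?a k * z ^ k) sums (c * z ^ n)" for z
    using sums_single[of n "\<lambda>k. c * z ^ k"] by (simp add: if_distrib[of "\<lambda>x. x * _"] cong: if_cong)
  show "power_series ?a z = c * z ^ n"
    unfolding power_series_def by (rule sums_unique[OF sums, symmetric])
  have a: "everywhere_convergent ?a"
    unfolding everywhere_convergent_def using sums sums_summable by blast
  have "(\<Sum>k. ennreal ((cmod (?a k))\<^sup>2) * ennreal (weight_moment W k)) =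
      (\<Sum>k\<in>{n}. ennreal ((cmod (?a k))\<^sup>2) * ennreal (weight_moment W k))"
    by (rule suminf_finite) auto
  hence S: "(\<Sum>k. ennreal ((cmod (?a k))\<^sup>2) * ennreal (weight_moment W k)) =
      ennreal ((cmod c)\<^sup>2 * weight_moment W n)"
    by (simp add: ennreal_mult weight_moment_nonneg)
  show "power_series ?a \<in> fock_space W"
    unfolding power_series_in_fock_space_iff[OF a] S by simp
  show "fock_norm W (power_series ?a) = cmod c * sqrt (weight_moment W n)"
    unfolding fock_norm_power_series[OF a] S by (simp add: weight_moment_nonneg real_sqrt_mult)
qed

lemma admissible_radius_le:
  assumes "admissible_radius W R" and m0: "weight_moment W 0 = 1"
  shows "R \<le> sqrt (weight_moment W 1)"
proof -
  let ?f = "power_series (\<lambda>k. if k = 0 then of_real R else 0)"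
  let ?g = "power_series (\<lambda>k. if k = 1 then 1 else 0)"
  have R: "R > 0" using assms(1) by (simp add: admissible_radius_def)
  have "cmod (?f z) \<le> cmod (?g z)" if "cmod z > R" for z
    unfolding fock_norm_monomial(1) using that R by simp
  hence "fock_norm W ?f \<le> fock_norm W ?g"
    using assms(1) fock_norm_monomial(2) unfolding admissible_radius_def by blast
  thus ?thesis unfolding fock_norm_monomial(3) using R by (simp add: m0)
qed

lemma admissible_radius_sqrt_moment:
  assumes m0: "weight_moment W 0 = 1"
  shows "admissible_radius W (sqrt (weight_moment W 1))"
  unfolding admissible_radius_def
proof (intro conjI ballI impI)
  define s where "s = weight_moment W 1"
  have s: "s > 0" using weight_moment_1_pos by (simp add: s_def)
  thus "sqrt (weight_moment W 1) > 0" by (simp add: s_def)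
  fix f g assume f: "f \<in> fock_space W" and g: "g \<in> fock_space W"
    and le: "\<forall>z. cmod z > sqrt (weight_moment W 1) \<longrightarrow> cmod (f z) \<le> cmod (g z)"
  obtain a where a: "everywhere_convergent a" "f = power_series a"
    using f entire_power_series by (auto simp: fock_space_def)
  obtain b where b: "everywhere_convergent b" "g = power_series b"
    using g entire_power_series by (auto simp: fock_space_def)
  \<comment> \<open>The k-th term of the norm factors as (|a_k|^2 s^k) w_k: a Parseval term on the
    circle |z|^2 = s times a nondecreasing weight.\<close>
  define w where "w k = weight_moment W k / s ^ k" for k
  define d where "d k = (if k = 0 then w 0 else w k - w (k - 1))" for k
  have mono: "w k \<le> w (Suc k)" for k
    using weight_moment_Suc_ge[OF m0, of k] s by (simp add: w_def s_def field_simps)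
  have d0: "d k \<ge> 0" for k
    using mono[of "k - 1"] by (cases k) (auto simp: d_def w_def m0)
  have dw: "w k = (\<Sum>n\<le>k. d n)" for k
    by (induction k) (auto simp: d_def)
  let ?t = "\<lambda>a k. ennreal ((cmod (a k))\<^sup>2 * s ^ k)"
  have weighted: "ennreal ((cmod (a k))\<^sup>2) * ennreal (weight_moment W k) = ?t a k * ennreal (w k)" for a :: "nat \<Rightarrow> complex" and k
    using s weight_moment_nonneg[of k] by (simp add: w_def flip: ennreal_mult)
  have "(\<Sum>k. ?t a k * ennreal (w k)) \<le> (\<Sum>k. ?t b k * ennreal (w k))"
  proof (rule suminf_abel_le)
    show "ennreal (w k) = (\<Sum>n\<le>k. ennreal (d n))" for k
      unfolding dw using d0 by simp
    fix n
    have b': "summable (\<lambda>j. (cmod (b (j + n)))\<^sup>2 * s ^ (j + n))"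
      using summable_coeff_squares[OF b(1), of s] s
      by (subst summable_iff_shift) simp
    have bn: "ennreal (\<Sum>j. (cmod (b (j + n)))\<^sup>2 * s ^ (j + n)) = (\<Sum>k. if n \<le> k then ?t b k else 0)"
    proof -
      let ?h = "\<lambda>k. if n \<le> k then (cmod (b k))\<^sup>2 * s ^ k else 0"
      have h: "summable ?h"
        using b' by (subst summable_iff_shift[of _ n, symmetric]) simp
      have "(\<Sum>j. (cmod (b (j + n)))\<^sup>2 * s ^ (j + n)) = (\<Sum>k. ?h k)"
        using suminf_split_initial_segment[OF h, of n] by simp
      also have "ennreal \<dots> = (\<Sum>k. ennreal (?h k))"
        by (rule suminf_ennreal2[OF _ h, symmetric]) (use s in auto)
      also have "\<dots> = (\<Sum>k. if n \<le> k then ?t b k else 0)"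
        by (intro suminf_cong) simp
      finally show ?thesis .
    qed
    show "(\<Sum>k. if n \<le> k then ?t a k else 0) \<le> (\<Sum>k. if n \<le> k then ?t b k else 0)"
    \<comment> \<open>Partial sums suffice, and they are the finite blocks bounded by
      \<open>tail_sum_le\<close>.\<close>
    proof (rule suminf_le_const)
      fix N
      have "(\<Sum>k<N. if n \<le> k then ?t a k else 0) = (\<Sum>k\<in>{n..<N}. ?t a k)"
        by (rule sum.mono_neutral_cong_right) auto
      also have "\<dots> = ennreal (\<Sum>k\<in>{n..<N}. (cmod (a k))\<^sup>2 * s ^ k)"
        using s by (intro sum_ennreal) simp
      also have "\<dots> \<le> ennreal (\<Sum>j. (cmod (b (j + n)))\<^sup>2 * s ^ (j + n))"
        using tail_sum_le[OF a(1) b(1), of "sqrt s" n N] le s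
        by (intro ennreal_leI) (simp add: a(2) b(2) s_def)
      finally show "(\<Sum>k<N. if n \<le> k then ?t a k else 0) \<le> (\<Sum>k. if n \<le> k then ?t b k else 0)"
        unfolding bn .
    qed simp
  qed
  hence "(\<Sum>k. ennreal ((cmod (a k))\<^sup>2) * ennreal (weight_moment W k)) \<le>
      (\<Sum>k. ennreal ((cmod (b k))\<^sup>2) * ennreal (weight_moment W k))"
    unfolding weighted .
  \<comment> \<open>Finiteness of the larger sum matters: \<open>enn2real\<close> sends infinity to
    0 and is monotone only below infinity. It comes from \<open>g\<close> lying in the
    space.\<close>
  thus "fock_norm W f \<le> fock_norm W g"
    using g power_series_in_fock_space_iff[OF b(1)]
    unfolding a(2) b(2) fock_norm_power_series[OF a(1)] fock_norm_power_series[OF b(1)]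
    by (intro real_sqrt_le_mono enn2real_mono) auto
qed

lemma korenblum_radius_eq:
  assumes "weight_moment W 0 = 1"
  shows "korenblum_radius W = ereal (sqrt (weight_moment W 1))"
  unfolding korenblum_radius_def
proof (rule antisym)
  show "(SUP R\<in>{R. admissible_radius W R}. ereal R) \<le> ereal (sqrt (weight_moment W 1))"
    by (rule SUP_least) (use admissible_radius_le assms in auto)
  show "ereal (sqrt (weight_moment W 1)) \<le> (SUP R\<in>{R. admissible_radius W R}. ereal R)"
    by (rule SUP_upper) (use admissible_radius_sqrt_moment assms in auto)
qed

end

section \<open>Moments of max(T, s)\<close>

text \<open>Both sides vanish at the kink t = s. The coefficients n + 1 and -n (in units of s) are
  those for which the left and the right derivatives there agree as well. On integration the term in
  t - s drops out when s is the mean.\<close>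

lemma power_minus_max_ge:
  fixes s t :: real
  assumes "s > 0" and "t \<ge> 0"
  shows "t ^ (n + 2) - s * (max t s) ^ (n + 1) \<ge>
    (real n + 1) * s ^ n * (t\<^sup>2 - s * max t s) - real n * s ^ (n + 1) * (t - s)"
proof -
  define x where "x = t / s"
  have x: "t = s * x" "x \<ge> 0" using assms by (auto simp: x_def)
  have mx: "max t s = s * max x 1" using assms(1) by (auto simp: x(1) max_def)
  have main: "x ^ (n + 2) - (max x 1) ^ (n + 1) \<ge> (real n + 1) * (x\<^sup>2 - max x 1) - real n * (x - 1)"
  proof (cases "x \<ge> 1")
    case True
    \<comment> \<open>After the common factor x - 1 is taken out, the claim for x >= 1 is
      Bernoulli's inequality.\<close>
    have "1 + real (Suc n) * (x - 1) \<le> (1 + (x - 1)) ^ Suc n"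
      using True by (intro Bernoulli_inequality) simp
    hence "0 \<le> (x - 1) * (x ^ Suc n - (1 + real (Suc n) * (x - 1)))"
      using True by (intro mult_nonneg_nonneg) simp_all
    thus ?thesis using True by (simp add: max_absorb1 power2_eq_square algebra_simps)
  next
    case False
    \<comment> \<open>For x < 1 the common factor is 1 - x, and what remains bounds a geometric sum
      by replacing each power beyond the constant term by x.\<close>
    have "(\<Sum>i<n + 2. x ^ i) = 1 + (\<Sum>i<n + 1. x ^ Suc i)"
      using sum.lessThan_Suc_shift[of "\<lambda>i. x ^ i" "n + 1"] by simp
    also have "(\<Sum>i<n + 1. x ^ Suc i) \<le> (\<Sum>i<n + 1. x)"
    proof (rule sum_mono)
      fix i
      show "x ^ Suc i \<le> x"
        using power_decreasing[of 1 "Suc i" x] False x(2) by simp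
    qed
    finally have "(\<Sum>i<n + 2. x ^ i) \<le> 1 + (real n + 1) * x" by (simp add: algebra_simps)
    hence "(1 - x) * (\<Sum>i<n + 2. x ^ i) \<le> (1 - x) * (1 + (real n + 1) * x)"
      using False by (intro mult_left_mono) simp_all
    moreover have "1 - x ^ (n + 2) = (1 - x) * (\<Sum>i<n + 2. x ^ i)"
      by (rule one_diff_power_eq)
    ultimately have "1 - x ^ (n + 2) \<le> (1 - x) * (1 + (real n + 1) * x)" by simp
    thus ?thesis using False by (simp add: max_absorb2 power2_eq_square algebra_simps)
  qed
  have "s ^ (n + 2) * ((real n + 1) * (x\<^sup>2 - max x 1) - real n * (x - 1)) \<le>
      s ^ (n + 2) * (x ^ (n + 2) - (max x 1) ^ (n + 1))"
    using main assms(1) by (intro mult_left_mono) simp_all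
  thus ?thesis
    unfolding mx unfolding x(1) by (simp add: power_mult_distrib power2_eq_square algebra_simps)
qed

context prob_space
begin

text \<open>The lower bounds on the moments always hold, as max(T, s) >= T. Among the upper bounds k
  = 1 is an equality, k = 2 is the variance condition rewritten through max(T, s) = s + (T - s)_+,
  and k >= 3 follows from k = 2 by \<open>power_minus_max_ge\<close>.\<close>

lemma max_moments_iff:
  fixes T :: "'a \<Rightarrow> real"
  assumes T[measurable]: "T \<in> borel_measurable M" and pos: "AE x in M. T x \<ge> 0"
    and int: "\<And>k::nat. integrable M (\<lambda>x. T x ^ k)"
    and s: "s = expectation T" "s > 0"
  shows "(\<forall>k::nat. k \<ge> 1 \<longrightarrow> expectation (\<lambda>x. max (T x) s ^ k) \<ge> expectation (\<lambda>x. T x ^ k) \<and>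
      s * expectation (\<lambda>x. max (T x) s ^ (k - 1)) \<le> expectation (\<lambda>x. T x ^ k)) \<longleftrightarrow>
    s * expectation (\<lambda>x. max (T x - s) 0) \<le> variance T"
proof -
  have [simp]: "integrable M T" using int[of 1] by simp
  have imax [simp]: "integrable M (\<lambda>x. max (T x) s ^ k)" for k
  proof (rule Bochner_Integration.integrable_bound)
    show "integrable M (\<lambda>x. T x ^ k + s ^ k)" using int by simp
    show "AE x in M. norm (max (T x) s ^ k) \<le> norm (T x ^ k + s ^ k)"
      using pos by eventually_elim (use s(2) in \<open>auto simp: max_def\<close>)
  qed measurable
  have var: "variance T = expectation (\<lambda>x. (T x)\<^sup>2) - s\<^sup>2"
    unfolding s(1) by (rule variance_eq) (use int[of 2] in auto)
  have "expectation (\<lambda>x. max (T x) s) = expectation (\<lambda>x. s + max (T x - s) 0)"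
    by (intro Bochner_Integration.integral_cong) (auto simp: max_def)
  also have "\<dots> = s + expectation (\<lambda>x. max (T x - s) 0)"
    by (subst Bochner_Integration.integral_add) (auto simp: prob_space)
  finally have emax: "expectation (\<lambda>x. max (T x) s) = s + expectation (\<lambda>x. max (T x - s) 0)" .
  have two: "s * expectation (\<lambda>x. max (T x - s) 0) \<le> variance T \<longleftrightarrow>
      s * expectation (\<lambda>x. max (T x) s) \<le> expectation (\<lambda>x. (T x)\<^sup>2)"
    unfolding var emax by (simp add: power2_eq_square distrib_left le_diff_eq add.commute)
  have ge: "expectation (\<lambda>x. T x ^ k) \<le> expectation (\<lambda>x. max (T x) s ^ k)" for k
    by (intro integral_mono_AE int imax, use pos in eventually_elim) (intro power_mono, auto)
  have upper: "s * expectation (\<lambda>x. max (T x) s ^ (n + 1)) \<le> expectation (\<lambda>x. T x ^ (n + 2))"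
    if le: "s * expectation (\<lambda>x. max (T x) s) \<le> expectation (\<lambda>x. (T x)\<^sup>2)" for n
  proof -
    let ?c = "(real n + 1) * s ^ n" and ?d = "real n * s ^ (n + 1)"
    have i1: "integrable M (\<lambda>x. max (T x) s)" using imax[of 1] by simp
    \<comment> \<open>The subtracted term is zero because s is the expectation of T.\<close>
    have "0 \<le> ?c * (expectation (\<lambda>x. (T x)\<^sup>2) - s * expectation (\<lambda>x. max (T x) s)) - ?d * (expectation T - s)"
      using le s by simp
    also have "\<dots> = expectation (\<lambda>x. ?c * ((T x)\<^sup>2 - s * max (T x) s) - ?d * (T x - s))"
      using int[of 2] i1 by (simp add: prob_space)
    also have "\<dots> \<le> expectation (\<lambda>x. T x ^ (n + 2) - s * max (T x) s ^ (n + 1))"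
    proof (rule integral_mono_AE)
      show "AE x in M. ?c * ((T x)\<^sup>2 - s * max (T x) s) - ?d * (T x - s) \<le> T x ^ (n + 2) - s * max (T x) s ^ (n + 1)"
        using pos by eventually_elim (rule power_minus_max_ge[OF s(2)])
    qed (use int[of 2] int[of "n + 2"] imax[of "n + 1"] i1 in \<open>simp_all del: power_Suc add_2_eq_Suc'\<close>)
    also have "\<dots> = expectation (\<lambda>x. T x ^ (n + 2)) - s * expectation (\<lambda>x. max (T x) s ^ (n + 1))"
      using int[of "n + 2"] imax[of "n + 1"] by (simp del: power_Suc add_2_eq_Suc')
    finally show ?thesis by simp
  qed
  show ?thesis
    unfolding two
  proof (intro iffI allI impI conjI)
    assume "\<forall>k::nat. k \<ge> 1 \<longrightarrow> expectation (\<lambda>x. max (T x) s ^ k) \<ge> expectation (\<lambda>x. T x ^ k) \<and>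
      s * expectation (\<lambda>x. max (T x) s ^ (k - 1)) \<le> expectation (\<lambda>x. T x ^ k)"
    from this[rule_format, of 2]
    show "s * expectation (\<lambda>x. max (T x) s) \<le> expectation (\<lambda>x. (T x)\<^sup>2)" by simp
  next
    fix k :: nat
    show "expectation (\<lambda>x. T x ^ k) \<le> expectation (\<lambda>x. max (T x) s ^ k)" by (rule ge)
  next
    fix k :: nat
    assume le: "s * expectation (\<lambda>x. max (T x) s) \<le> expectation (\<lambda>x. (T x)\<^sup>2)" and k: "k \<ge> 1"
    show "s * expectation (\<lambda>x. max (T x) s ^ (k - 1)) \<le> expectation (\<lambda>x. T x ^ k)"
    proof (cases "k = 1")
      case True
      with s show ?thesis by (simp add: prob_space)
    next
      case False
      with k have "k = (k - 2) + 2" by simp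
      then obtain n where "k = n + 2" by blast
      with upper[OF le, of n] show ?thesis by simp
    qed
  qed
qed

end

text \<open>The law of T is identified with the measure of density V, a Borel version of W, so that
  moments of T become integrals over \<open>lborel\<close>; the almost everywhere equality then
  leads back to W.\<close>

lemma density_on_half_line_moments:
  assumes W: "radial_weight W" and dens: "has_density_on_half_line M T W"
  shows "AE x in M. T x \<ge> 0" "integrable M (\<lambda>x. T x ^ k)" "(LINT x|M. T x ^ k) = weight_moment W k"
proof -
  have T[measurable]: "T \<in> borel_measurable M"
    using dens by (simp add: has_density_on_half_line_def)
  have em: "emeasure M (T -` A \<inter> space M) = (\<integral>\<^sup>+t\<in>A \<inter> {0..}. ennreal (W t) \<partial>lebesgue)"
    if "A \<in> sets borel" for A
    using dens that by (simp add: has_density_on_half_line_def)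
  obtain V where V[measurable]: "V \<in> borel_measurable borel" and V0: "\<And>t. V t \<ge> 0"
    and AE: "AE t in lborel. indicator {0..} t * W t = V t"
    using borel_version[OF W] by blast
  have distr: "distr M borel T = density lborel (\<lambda>t. ennreal (V t))"
  proof (rule measure_eqI)
    fix A assume "A \<in> sets (distr M borel T)"
    hence A: "A \<in> sets borel" by simp
    have "emeasure (distr M borel T) A = (\<integral>\<^sup>+t\<in>A \<inter> {0..}. ennreal (W t) \<partial>lborel)"
      using em[OF A] A by (simp add: emeasure_distr nn_integral_completion)
    also have "\<dots> = (\<integral>\<^sup>+t\<in>A. ennreal (V t) \<partial>lborel)"
    proof (rule nn_integral_cong_AE)
      show "AE t in lborel. ennreal (W t) * indicator (A \<inter> {0..}) t = ennreal (V t) * indicator A t"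
        using AE
      proof eventually_elim
        fix t assume "indicator {0..} t * W t = V t"
        thus "ennreal (W t) * indicator (A \<inter> {0..}) t = ennreal (V t) * indicator A t"
          by (cases "t \<ge> 0") (simp_all split: split_indicator)
      qed
    qed
    also have "\<dots> = emeasure (density lborel (\<lambda>t. ennreal (V t))) A"
      using A by (simp add: emeasure_density)
    finally show "emeasure (distr M borel T) A = emeasure (density lborel (\<lambda>t. ennreal (V t))) A" .
  qed simp
  have "emeasure M {x \<in> space M. \<not> T x \<ge> 0} = 0"
  proof -
    have "{x \<in> space M. \<not> T x \<ge> 0} = T -` {..<0} \<inter> space M" by auto
    moreover have "{..<0} \<inter> {0..} = ({} :: real set)" by auto
    ultimately show ?thesis using em[of "{..<0}"] by simp
  qed
  thus "AE x in M. T x \<ge> 0"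
    by (subst AE_iff_measurable[OF _ refl]) simp_all
  have eq: "AE t in lborel. indicator {0..} t * (t ^ k * W t) = V t * t ^ k"
    using AE
  proof eventually_elim
    fix t assume "indicator {0..} t * W t = V t"
    hence "indicator {0..} t * W t * t ^ k = V t * t ^ k" by (rule arg_cong)
    thus "indicator {0..} t * (t ^ k * W t) = V t * t ^ k" by (simp only: mult.assoc mult.commute[of "W t"])
  qed
  have meas: "(\<lambda>t. V t * t ^ k) \<in> borel_measurable lborel" by measurable
  have int: "integrable lebesgue (\<lambda>t. V t * t ^ k)"
    using radial_weight_integrable[OF W, of k] AE_completion[OF eq] measurable_completion[OF meas]
    by (subst integrable_cong_AE[where g = "\<lambda>t. indicator {0..} t * (t ^ k * W t)"]) (auto elim: AE_mp)
  hence int': "integrable lborel (\<lambda>t. V t * t ^ k)"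
    using meas by (simp add: integrable_completion)
  have "integrable (distr M borel T) (\<lambda>t. t ^ k)"
    unfolding distr by (subst integrable_density) (use int' V0 in auto)
  thus "integrable M (\<lambda>x. T x ^ k)"
    by (subst (asm) integrable_distr_eq) auto
  have "(LINT x|M. T x ^ k) = (LINT t|distr M borel T. t ^ k)"
    by (subst integral_distr) auto
  also have "\<dots> = (LINT t|lborel. V t * t ^ k)"
    unfolding distr by (subst integral_density) (use V0 in auto)
  also have "\<dots> = (LINT t|lebesgue. V t * t ^ k)"
    by (rule integral_completion[OF meas, symmetric])
  also have "\<dots> = weight_moment W k"
    unfolding weight_moment_eq[OF W]
    using AE_completion[OF eq] measurable_completion[OF meas] borel_measurable_integrable[OF radial_weight_integrable[OF W]]
    by (intro integral_cong_AE) (auto elim: AE_mp)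
  finally show "(LINT x|M. T x ^ k) = weight_moment W k" .
qed

theorem proposition6p1:
  fixes W :: "real \<Rightarrow> real"
    and M :: "'a measure"
    and T :: "'a \<Rightarrow> real"
    and s :: real
    and \<nu> :: "real measure"
  assumes weight: "radial_weight W"
    and m0: "weight_moment W 0 = 1"
    and prob: "prob_space M"
    and dens: "has_density_on_half_line M T W"
    and s: "s = weight_moment W 1"
    and nu: "\<nu> = distr M borel (\<lambda>x. max (T x) s)"
  shows "((\<forall>k::nat. k \<ge> 1 \<longrightarrow>
             (LINT t|\<nu>. t ^ k) \<ge> weight_moment W k \<and>
             s * (LINT t|\<nu>. t ^ (k - 1)) \<le> weight_moment W k)
          \<longleftrightarrow> s * prob_space.expectation M (\<lambda>x. max (T x - s) 0) \<le> prob_space.variance M T)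
       \<and> (s * prob_space.expectation M (\<lambda>x. max (T x - s) 0) \<le> prob_space.variance M T
          \<longrightarrow> korenblum_radius W = ereal (sqrt (weight_moment W 1 / weight_moment W 0))
            \<and> admissible_radius W (sqrt (weight_moment W 1 / weight_moment W 0)))"
proof -
  interpret prob_space M by (rule prob)
  note mom = density_on_half_line_moments[OF weight dens]
  have T[measurable]: "T \<in> borel_measurable M"
    using dens by (simp add: has_density_on_half_line_def)
  have nu_int: "(LINT t|\<nu>. t ^ k) = expectation (\<lambda>x. max (T x) s ^ k)" for k
    unfolding nu by (subst integral_distr) auto
  have sT: "s = expectation T" using mom(3)[of 1] s by simp
  have s0: "s > 0" unfolding s by (rule weight_moment_1_pos[OF weight])
  show ?thesis
    unfolding nu_int
    using max_moments_iff[OF T mom(1,2) sT s0]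
      korenblum_radius_eq[OF weight m0] admissible_radius_sqrt_moment[OF weight m0] m0
    by (simp only: mom(3) div_by_1 simp_thms)
qed

end
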